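(* Let $\mathcal{X},\mathcal{Y}$ be real Hilbert spaces, $f\colon\mathcal{X}\to\mathbb{R}\cup\{+\infty\}$ a proper, convex and lower semicontinuous function, $h\colon\mathcal{X}\to\mathbb{R}$ a convex differentiable function whose gradient is $\frac1\beta$-Lipschitz continuous with $\beta>0$, $A\colon\mathcal{X}\to\mathcal{Y}$ a linear continuous operator, and $b\in\mathcal{Y}$. Consider the problem of minimizing $f(x)+h(x)$ over $x\in\mathcal{X}$ subject to $Ax=b$, with Lagrangian $\mathcal{L}(x,\lambda):=f(x)+h(x)+\langle\lambda,Ax-b\rangle$, and let $\mathcal{S}$ be its set of primal-dual optimal solutions (saddle points of $\mathcal{L}$). Let $(x_*,\lambda_* )\in\mathcal{S}$. Let $\alpha>2$ and $\tau,\sigma>0$ be such that $$1<\min\Big\{\frac1\tau,\frac1\sigma\Big\}\Big(1-\sqrt{\tau\sigma\|A\|^2}\Big)\frac{8(\alpha-1)}{5\alpha-2}\beta.$$ Let $x_0,v_0\in\mathcal{X}$, $\lambda_0,\eta_0\in\mathcal{Y}$, $x_1:=\operatorname{prox}_{\tau f}(v_0-\tau A^*\eta_0-\tau\nabla h(x_0))$, $\lambda_1:=\eta_0+\sigma(Ax_1-b)+\sigma A(x_1-v_0)$, and for every $k\ge1$ $$\begin{aligned} v_k&:=x_k+\Big(1-\tfrac{\alpha}{k+\alpha}\Big)(x_k-x_{k-1})+\Big(1-\tfrac{\alpha}{2(k+\alpha)}\Big)(v_{k-1}-x_k),\\ \eta_k&:=\lambda_k+\Big(1-\tfrac{\alpha}{k+\alpha}\Big)(\lambda_k-\lambda_{k-1})+\Big(1-\tfrac{\alpha}{2(k+\alpha)}\Big)(\eta_{k-1}-\lambda_k),\\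 x_{k+1}&:=\operatorname{prox}_{\tau f}\big(v_k-\tau A^*\eta_k-\tau\nabla h(x_k)\big),\\ \lambda_{k+1}&:=\eta_k+\sigma(Ax_{k+1}-b)+\sigma A(x_{k+1}-v_k). \end{aligned}$$ Then: (i) the sequence $(x_k,\lambda_k)_{k\ge0}$ converges weakly to an element of $\mathcal{S}$; (ii) for every $k\ge1$, $$w_{k+1}:=\frac1\tau(v_k-x_{k+1})+A^*(\lambda_{k+1}-\eta_k)-\nabla h(x_k)\in\partial f(x_{k+1})+A^*\lambda_{k+1},$$ and, as $k\to+\infty$, $$\|x_k-x_{k-1}\|=o\Big(\frac1k\Big),\quad \|\lambda_k-\lambda_{k-1}\|=o\Big(\frac1k\Big),\quad \|w_k+\nabla h(x_k)\|=o\Big(\frac1k\Big),\quad \|Ax_k-b\|=o\Big(\frac1k\Big),$$ $$\mathcal{L}(x_k,\lambda_* )-\mathcal{L}(x_*,\lambda_k)=o\Big(\frac1k\Big),\qquad \big|(f+h)(x_k)-(f+h)(x_* )\big|=o\Big(\frac1k\Big).$$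
   Context: $A^*\colon\mathcal{Y}\to\mathcal{X}$ is the adjoint of $A$, $\partial f$ the convex subdifferential of $f$, and $\operatorname{prox}_{\tau f}(x):=\operatorname{argmin}_{u\in\mathcal{X}}\{f(u)+\frac1{2\tau}\|u-x\|^2\}=(\mathrm{Id}+\tau\partial f)^{-1}(x)$. A pair $(x_*,\lambda_* )\in\mathcal{X}\times\mathcal{Y}$ is a saddle point of $\mathcal{L}\colon\mathcal{X}\times\mathcal{Y}\to\mathbb{R}\cup\{+\infty\}$ if $\mathcal{L}(x_*,\lambda)\le\mathcal{L}(x_*,\lambda_* )\le\mathcal{L}(x,\lambda_* )$ for all $(x,\lambda)\in\mathcal{X}\times\mathcal{Y}$; equivalently, $0\in\partial f(x_* )+\nabla h(x_* )+A^*\lambda_*$ and $Ax_*=b$. Weak convergence of $(x_k,\lambda_k)$ is in the product Hilbert space $\mathcal{X}\oplus\mathcal{Y}$. *)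

theory Defs
  imports "HOL-Analysis.Analysis" "HOL-Library.Landau_Symbols"
begin

definition proper_fun :: "('a \<Rightarrow> ereal) \<Rightarrow> bool" where
  "proper_fun f \<longleftrightarrow> (\<forall>x. f x \<noteq> -\<infinity>) \<and> (\<exists>x. f x \<noteq> \<infinity>)"

text \<open>The library's \<^const>\<open>convex_on\<close> is restricted to real-valued functions.\<close>

definition convex_ereal :: "('a::real_vector \<Rightarrow> ereal) \<Rightarrow> bool" where
  "convex_ereal f \<longleftrightarrow>
     (\<forall>x y t. 0 < t \<and> t < 1 \<longrightarrow>
        f ((1 - t) *\<^sub>R x + t *\<^sub>R y) \<le> ereal (1 - t) * f x + ereal t * f y)"

definition lower_semicontinuous :: "('a::topological_space \<Rightarrow> ereal) \<Rightarrow> bool" where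
  "lower_semicontinuous f \<longleftrightarrow> (\<forall>x. f x \<le> Liminf (at x) f)"

text \<open>As usual, the subdifferential is empty outside the effective domain.\<close>

definition subdifferential :: "('a::real_inner \<Rightarrow> ereal) \<Rightarrow> 'a \<Rightarrow> 'a set" where
  "subdifferential f x =
     {u. \<bar>f x\<bar> \<noteq> \<infinity> \<and> (\<forall>y. f x + ereal (u \<bullet> (y - x)) \<le> f y)}"

definition prox :: "real \<Rightarrow> ('a::real_inner \<Rightarrow> ereal) \<Rightarrow> 'a \<Rightarrow> 'a" where
  "prox \<tau> f x = (ARG_MIN (\<lambda>u. f u + ereal (1 / (2 * \<tau>) * (norm (u - x))\<^sup>2)) u. True)"

definition gradient :: "('a::real_inner \<Rightarrow> real) \<Rightarrow> 'a \<Rightarrow> 'a" where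
  "gradient h x = (THE g. GDERIV h x :> g)"

definition lagrangian ::
  "('a::real_inner \<Rightarrow> ereal) \<Rightarrow> ('a \<Rightarrow> real) \<Rightarrow> ('a \<Rightarrow> 'b::real_inner) \<Rightarrow> 'b \<Rightarrow> 'a \<Rightarrow> 'b \<Rightarrow> ereal" where
  "lagrangian f h A b x l = f x + ereal (h x) + ereal (l \<bullet> (A x - b))"

definition saddle_points :: "('a \<Rightarrow> 'b \<Rightarrow> ereal) \<Rightarrow> ('a \<times> 'b) set" where
  "saddle_points L =
     {(xs, ls). \<forall>x l. L xs l \<le> L xs ls \<and> L xs ls \<le> L x ls}"

definition weakly_tendsto :: "(nat \<Rightarrow> 'a::real_inner) \<Rightarrow> 'a \<Rightarrow> bool" where
  "weakly_tendsto z l \<longleftrightarrow> (\<forall>y. (\<lambda>k. z k \<bullet> y) \<longlonglongrightarrow> l \<bullet> y)"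

text \<open>Because \<^const>\<open>real_of_ereal\<close> sends infinite values to \<open>0\<close>, the little-o relation for an
  extended-real sequence has to demand eventual finiteness separately.\<close>

definition smallo_ereal :: "(nat \<Rightarrow> ereal) \<Rightarrow> (nat \<Rightarrow> real) \<Rightarrow> bool" where
  "smallo_ereal u g \<longleftrightarrow>
     (\<forall>\<^sub>F k in sequentially. \<bar>u k\<bar> \<noteq> \<infinity>) \<and> (\<lambda>k. real_of_ereal (u k)) \<in> o(g)"

end

theory Submission
  imports Defs
begin

text \<open>
  Put \<open>z\<^sub>k = (x\<^sub>k, \<lambda>\<^sub>k)\<close>, \<open>\<Delta>\<^sub>k = z\<^sub>k - z\<^sub>k\<^sub>-\<^sub>1\<close> and \<open>g\<^sub>k = (v\<^sub>k\<^sub>-\<^sub>1, \<eta>\<^sub>k\<^sub>-\<^sub>1) - z\<^sub>k\<close>. In the metric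
  \<open>M = [[1/\<tau>, -A\<^sup>*], [-A, 1/\<sigma>]]\<close>, which is coercive with a constant \<open>m\<close> such that \<open>m \<beta> > 1/2\<close>, the
  iteration is a forward-backward method: \<open>M g\<^sub>k\<close> is an element of the monotone part at \<open>z\<^sub>k\<close> plus the
  cocoercive part at \<open>z\<^sub>k\<^sub>-\<^sub>1\<close>, and
  \<open>(k + \<alpha>) \<Delta>\<^sub>k\<^sub>+\<^sub>1 = k \<Delta>\<^sub>k - (k + \<alpha>) (g\<^sub>k\<^sub>+\<^sub>1 - g\<^sub>k) - (\<alpha>/2) g\<^sub>k\<close>.
  With \<open>a\<^sub>k = z\<^sub>k - z\<^sub>*\<close> and \<open>y\<^sub>k = k \<Delta>\<^sub>k + (k + \<alpha>/2) g\<^sub>k\<close>, the energy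
  \<open>(\<parallel>k \<Delta>\<^sub>k\<parallel>\<^sup>2 + \<parallel>y\<^sub>k\<parallel>\<^sup>2)/4 + \<mu> ((\<alpha> - 1)/2 \<parallel>a\<^sub>k\<parallel>\<^sup>2 + \<langle>a\<^sub>k, y\<^sub>k\<rangle>)\<close> is
  eventually nonnegative and decreasing for every \<open>1 < \<mu> < \<alpha> - 1\<close>, at a rate proportional to
  \<open>k (\<parallel>\<Delta>\<^sub>k\<parallel>\<^sup>2 + \<parallel>g\<^sub>k\<parallel>\<^sup>2)\<close>. Since it is affine in \<open>\<mu>\<close>, two values of \<open>\<mu>\<close> show that both of its parts
  converge. Summability forces the first part to tend to \<open>0\<close>, which gives all the rates; then the
  second part shows that \<open>\<parallel>a\<^sub>k\<parallel>\<close> converges, and weak convergence follows by Opial's argument.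
\<close>

subsection \<open>Minimisation in Hilbert spaces\<close>

text \<open>A level strictly between \<open>s\<close> and \<open>f c\<close> would be exceeded by
  \<open>f\<close> on a neighbourhood of \<open>c\<close>, hence eventually by the bounds
  \<open>r n\<close>, whose limit is \<open>s\<close>.\<close>

lemma lower_semicontinuous_seq:
  fixes f :: "'a::real_normed_vector \<Rightarrow> ereal"
  assumes lsc: "lower_semicontinuous f" and u: "(u \<longlongrightarrow> c) F" and r: "(r \<longlongrightarrow> s) F"
    and le: "\<forall>\<^sub>F n in F. f (u n) \<le> ereal (r n)" and F: "F \<noteq> bot"
  shows "f c \<le> ereal s"
proof (rule ccontr)
  assume "\<not> f c \<le> ereal s"
  then obtain t where t: "ereal s < ereal t" "ereal t < f c"
    by (metis ereal_dense2 not_le)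
  have "f c \<le> Liminf (at c) f"
    using lsc unfolding lower_semicontinuous_def by blast
  then have "eventually (\<lambda>y. ereal t < f y) (at c)"
    using t(2) unfolding le_Liminf_iff by blast
  \<comment> \<open>\<open>at c\<close> omits \<open>c\<close> itself, but \<open>t < f c\<close>
    supplies that point.\<close>
  then have "eventually (\<lambda>y. ereal t < f y) (nhds c)"
    using t(2) by (auto simp: eventually_at_filter elim!: eventually_mono)
  then have "\<forall>\<^sub>F n in F. ereal t < f (u n)"
    using u unfolding filterlim_iff by blast
  with le have "\<forall>\<^sub>F n in F. t \<le> r n"
    by eventually_elim (use order.strict_trans2 in fastforce)
  then have "t \<le> s"
    using tendsto_lowerbound[OF r _ F] by blast
  with t show False by simp
qed

text \<open>The parallelogram law centred at \<open>x\<close>; its negative last term is the gain of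
  uniform convexity used below.\<close>

lemma norm_midpoint_sq:
  fixes u v :: "'a::real_inner"
  shows "(norm (((1/2) *\<^sub>R u + (1/2) *\<^sub>R v) - x))\<^sup>2
    = (norm (u - x))\<^sup>2 / 2 + (norm (v - x))\<^sup>2 / 2 - (norm (u - v))\<^sup>2 / 4"
  unfolding power2_norm_eq_inner by (simp add: algebra_simps inner_commute) (simp add: field_simps)

text \<open>Uniform convexity of \<open>\<phi>\<close> makes every minimising sequence a Cauchy sequence.\<close>

lemma uniformly_convex_has_minimizer:
  fixes \<phi> :: "'a::{real_normed_vector, complete_space} \<Rightarrow> ereal"
  assumes lsc: "\<And>u c r s. \<lbrakk>u \<longlonglongrightarrow> c; r \<longlonglongrightarrow> s; \<And>n. \<phi> (u n) \<le> ereal (r n)\<rbrakk> \<Longrightarrow> \<phi> c \<le> ereal s"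
    and dom: "\<phi> w < \<infinity>" and bdd: "\<And>u. ereal m \<le> \<phi> u" and c: "c > 0"
    and conv: "\<And>u v r s. \<lbrakk>\<phi> u \<le> ereal r; \<phi> v \<le> ereal s\<rbrakk> \<Longrightarrow>
      \<phi> ((1/2) *\<^sub>R u + (1/2) *\<^sub>R v) \<le> ereal ((r + s) / 2 - c * (norm (u - v))\<^sup>2)"
  shows "\<exists>p. \<forall>u. \<phi> p \<le> \<phi> u"
proof -
  define I where "I = (INF u. \<phi> u)"
  have "ereal m \<le> I" unfolding I_def by (rule INF_greatest) (rule bdd)
  moreover have "I \<le> \<phi> w" unfolding I_def by (rule INF_lower) simp
  ultimately obtain i where i: "I = ereal i" using dom by (cases I) auto
  have low: "ereal i \<le> \<phi> u" for u
    unfolding i[symmetric] I_def by (rule INF_lower) simp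
  define q where "q n = inverse (real (Suc n))" for n
  have "\<exists>u. \<phi> u \<le> ereal (i + q n)" for n
  proof -
    have "I < ereal (i + q n)" using i by (simp add: q_def)
    then show ?thesis unfolding I_def INF_less_iff by (meson less_imp_le)
  qed
  then obtain u where u: "\<And>n. \<phi> (u n) \<le> ereal (i + q n)" by metis
  \<comment> \<open>The midpoint has value at least \<open>i\<close>, so the convexity gain cannot
    exceed the mean slack of the two points.\<close>
  have close: "c * (norm (u n - u k))\<^sup>2 \<le> (q n + q k) / 2" for n k
    using order.trans[OF low conv[OF u[of n] u[of k]]] by (simp add: add_divide_distrib)
  have "Cauchy u"
  proof (rule CauchyI)
    fix e :: real assume e: "0 < e"
    then have "c * e\<^sup>2 > 0" using c by simp
    then obtain N where N: "q N < c * e\<^sup>2"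
      unfolding q_def using reals_Archimedean by blast
    show "\<exists>M. \<forall>n\<ge>M. \<forall>k\<ge>M. norm (u n - u k) < e"
    proof (intro exI allI impI)
      fix n k assume nk: "N \<le> n" "N \<le> k"
      have "q n \<le> q N" "q k \<le> q N"
        using nk by (auto simp: q_def field_simps)
      then have "(q n + q k) / 2 \<le> q N" by simp
      with close[of n k] N have "c * (norm (u n - u k))\<^sup>2 < c * e\<^sup>2"
        by (meson order.trans order.strict_trans1)
      then show "norm (u n - u k) < e"
        using c e by (simp add: power_less_imp_less_base)
    qed
  qed
  then obtain p where p: "u \<longlonglongrightarrow> p" using Cauchy_convergent convergent_def by blast
  have "(\<lambda>n. i + q n) \<longlonglongrightarrow> i"
    unfolding q_def by (rule LIMSEQ_inverse_real_of_nat_add)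
  from lsc[OF p this u] have "\<phi> p \<le> ereal i" .
  with low show ?thesis using order.trans by blast
qed

text \<open>The representing vector is the minimiser of \<open>\<phi>\<close>: there the derivative
  in every direction \<open>u\<close>, the number \<open>d\<close> below, must vanish.\<close>

theorem riesz_representation:
  fixes \<psi> :: "'a::{real_inner, complete_space} \<Rightarrow> real"
  assumes "bounded_linear \<psi>"
  shows "\<exists>p. \<forall>u. \<psi> u = p \<bullet> u"
proof -
  interpret bounded_linear \<psi> by fact
  define \<phi> where "\<phi> u = (norm u)\<^sup>2 / 2 - \<psi> u" for u
  have "\<exists>p. \<forall>u. ereal (\<phi> p) \<le> ereal (\<phi> u)"
  \<comment> \<open>\<open>m\<close> comes from completing the square in \<open>norm u\<close>;
    \<open>1/8\<close> is half the parallelogram constant \<open>1/4\<close>.\<close>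
  proof (rule uniformly_convex_has_minimizer[where c = "1/8" and w = 0 and m = "- (onorm \<psi>)\<^sup>2 / 2"])
    fix u c r s assume "u \<longlonglongrightarrow> c" "r \<longlonglongrightarrow> s" "\<And>n. ereal (\<phi> (u n)) \<le> ereal (r n)"
    moreover from this(1) have "(\<lambda>n. \<phi> (u n)) \<longlonglongrightarrow> \<phi> c"
      unfolding \<phi>_def by (intro tendsto_intros tendsto) auto
    ultimately show "ereal (\<phi> c) \<le> ereal s" by (auto intro: LIMSEQ_le)
  next
    fix u
    have "\<psi> u \<le> onorm \<psi> * norm u" using onorm[OF assms, of u] by simp
    moreover have "0 \<le> (onorm \<psi> - norm u)\<^sup>2" by simp
    ultimately show "ereal (- (onorm \<psi>)\<^sup>2 / 2) \<le> ereal (\<phi> u)"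
      by (simp add: \<phi>_def power2_eq_square algebra_simps)
  next
    fix u v :: 'a and r s assume "ereal (\<phi> u) \<le> ereal r" "ereal (\<phi> v) \<le> ereal s"
    moreover have "\<phi> ((1/2) *\<^sub>R u + (1/2) *\<^sub>R v) = (\<phi> u + \<phi> v) / 2 - (1/8) * (norm (u - v))\<^sup>2"
      using norm_midpoint_sq[of u v 0] by (simp add: \<phi>_def add scaleR field_simps)
    ultimately show "ereal (\<phi> ((1/2) *\<^sub>R u + (1/2) *\<^sub>R v)) \<le> ereal ((r + s) / 2 - (1/8) * (norm (u - v))\<^sup>2)"
      by simp
  next
    show "ereal (\<phi> 0) < \<infinity>" by simp
  next
    show "(0::real) < 1/8" by simp
  qed
  then obtain p where p: "\<phi> p \<le> \<phi> u" for u by auto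
  have "\<psi> u = p \<bullet> u" for u
  proof -
    define d where "d = p \<bullet> u - \<psi> u"
    have main: "0 \<le> t * d + t\<^sup>2 * ((norm u)\<^sup>2 / 2)" for t
    proof -
      have "\<phi> (p + t *\<^sub>R u) = \<phi> p + t * d + t\<^sup>2 * ((norm u)\<^sup>2 / 2)"
        unfolding \<phi>_def d_def add scaleR power2_norm_eq_inner
        by (simp add: algebra_simps inner_commute power2_eq_square)
      with p[of "p + t *\<^sub>R u"] show ?thesis by linarith
    qed
    have "d = 0"
    proof (rule ccontr)
      assume d: "d \<noteq> 0"
      \<comment> \<open>\<open>t = - d / n\<close> minimises
        \<open>t * d + t\<^sup>2 * (n / 2)\<close>; the summand \<open>1\<close> avoids division by
        zero when \<open>u = 0\<close>.\<close>
      define n where "n = (norm u)\<^sup>2 + 1"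
      have n: "n > 0" unfolding n_def by (simp add: add_nonneg_pos)
      have "(d/n)\<^sup>2 * ((norm u)\<^sup>2 / 2) \<le> (d/n)\<^sup>2 * (n / 2)"
        by (intro mult_left_mono) (auto simp: n_def)
      with main[of "- d / n"] have "0 \<le> - d / n * d + (d/n)\<^sup>2 * (n/2)" by simp
      also have "\<dots> = - (d\<^sup>2 / (2 * n))" using n by (simp add: field_simps power2_eq_square)
      finally show False using d n by (simp add: divide_le_0_iff)
    qed
    then show ?thesis by (simp add: d_def)
  qed
  then show ?thesis by blast
qed

text \<open>\<open>adjoint\<close> is defined by choice, so its identity requires existence: Riesz
  represents each functional \<open>\<lambda>x. A x \<bullet> y\<close>.\<close>

lemma adjoint_hilbert:
  fixes A :: "'x::{real_inner, complete_space} \<Rightarrow> 'y::real_inner"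
  assumes "bounded_linear A"
  shows "A x \<bullet> y = x \<bullet> adjoint A y"
proof -
  interpret bounded_linear A by fact
  have "\<exists>p. \<forall>x. A x \<bullet> y = x \<bullet> p" for y
    using riesz_representation[OF bounded_linear_inner_left_comp[OF assms, of y]]
    by (metis inner_commute)
  then have "\<exists>g. \<forall>x y. A x \<bullet> y = x \<bullet> g y" by metis
  then show ?thesis unfolding adjoint_def by (rule someI2_ex) blast
qed

lemma inner_left_unique:
  fixes a b :: "'a::real_inner"
  assumes "\<And>y. a \<bullet> y = b \<bullet> y"
  shows "a = b"
  by (metis assms inner_eq_zero_iff inner_diff_left right_minus_eq)

lemma adjoint_hilbert_diff:
  fixes A :: "'x::{real_inner, complete_space} \<Rightarrow> 'y::real_inner"
  assumes "bounded_linear A"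
  shows "adjoint A (y - z) = adjoint A y - adjoint A z"
  by (rule inner_left_unique)
    (metis adjoint_hilbert[OF assms] inner_commute inner_diff_right)

subsection \<open>Weak compactness of bounded sequences\<close>

text \<open>Instead of subsequences, which would require separability arguments, weak cluster
  points are described by finer filters; these are supplied by Tychonoff's theorem applied to the
  functionals \<open>y \<mapsto> z\<^sub>k \<bullet> y\<close>.\<close>

lemma bounded_imp_weakly_convergent_subfilter:
  fixes z :: "'i \<Rightarrow> 'a::{real_inner, complete_space}"
  assumes F: "F \<noteq> bot" and bdd: "\<And>k. norm (z k) \<le> R"
  shows "\<exists>G q. G \<noteq> bot \<and> G \<le> F \<and> (\<forall>y. ((\<lambda>k. z k \<bullet> y) \<longlongrightarrow> q \<bullet> y) G)"
proof -
  define T :: "'i \<Rightarrow> 'a \<Rightarrow> real" where "T k y = z k \<bullet> y" for k y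
  \<comment> \<open>Cauchy-Schwarz confines every functional \<open>T k\<close> to this box, which
    is compact by Tychonoff.\<close>
  define K :: "('a \<Rightarrow> real) set" where "K = (\<Pi>\<^sub>E y\<in>UNIV. {- R * norm y .. R * norm y})"
  have "compactin (product_topology (\<lambda>i. euclidean) UNIV) K"
    unfolding K_def compactin_PiE by simp
  then have "compact K" by (simp add: euclidean_product_topology)
  moreover have TK: "T k \<in> K" for k
  proof -
    have "\<bar>z k \<bullet> y\<bar> \<le> R * norm y" for y
      using Cauchy_Schwarz_ineq2[of "z k" y] mult_right_mono[OF bdd[of k] norm_ge_zero[of y]] by linarith
    then show ?thesis by (auto simp: K_def T_def abs_le_iff minus_le_iff)
  qed
  moreover have "filtermap T F \<noteq> bot" using F by (simp add: filtermap_bot_iff)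
  ultimately obtain \<psi> where \<psi>: "inf (nhds \<psi>) (filtermap T F) \<noteq> bot"
    unfolding compact_filter by (metis (mono_tags, lifting) TK always_eventually eventually_filtermap)
  \<comment> \<open>Pulling the neighbourhoods of \<open>\<psi>\<close> back along \<open>T\<close>
    refines \<open>F\<close> so that \<open>T\<close> converges; the refinement is proper because
    \<open>\<psi>\<close> is a cluster point.\<close>
  define G where "G = inf F (filtercomap T (nhds \<psi>))"
  have G: "G \<noteq> bot"
  proof
    assume "G = bot"
    then have "eventually (\<lambda>_. False) (inf F (filtercomap T (nhds \<psi>)))" by (simp add: G_def)
    then obtain P Q where PQ: "eventually P F" "eventually Q (filtercomap T (nhds \<psi>))"
      "\<And>k. P k \<Longrightarrow> Q k \<Longrightarrow> False" unfolding eventually_inf by blast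
    then obtain S where S: "eventually S (nhds \<psi>)" "\<And>k. S (T k) \<Longrightarrow> Q k"
      unfolding eventually_filtercomap by blast
    have "eventually (\<lambda>t. \<not> S t) (filtermap T F)"
      using PQ(1) unfolding eventually_filtermap by eventually_elim (use PQ(3) S(2) in blast)
    with S(1) have "eventually (\<lambda>_. False) (inf (nhds \<psi>) (filtermap T F))"
      unfolding eventually_inf by blast
    with \<psi> show False by (simp add: trivial_limit_def)
  qed
  have "filterlim T (nhds \<psi>) G"
    unfolding G_def by (meson filterlim_filtercomap filterlim_mono inf_le2 order_refl)
  then have T: "((\<lambda>k. z k \<bullet> y) \<longlongrightarrow> \<psi> y) G" for y
  proof -
    have "continuous_on UNIV (\<lambda>f::'a \<Rightarrow> real. f y)"
      by (rule continuous_on_product_coordinates)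
    from continuous_on_tendsto_compose[OF this \<open>filterlim T (nhds \<psi>) G\<close>]
    show ?thesis by (simp add: T_def)
  qed
  \<comment> \<open>Linearity and the bound \<open>R\<close> survive pointwise limits, so Riesz
    applies to \<open>\<psi>\<close>.\<close>
  have "bounded_linear \<psi>"
  proof (rule bounded_linear_intro)
    fix x y r
    show "\<psi> (x + y) = \<psi> x + \<psi> y"
      using tendsto_unique[OF G T[of "x + y"]] tendsto_add[OF T[of x] T[of y]]
      by (simp add: inner_add_right)
    show "\<psi> (r *\<^sub>R x) = r *\<^sub>R \<psi> x"
      using tendsto_unique[OF G T[of "r *\<^sub>R x"]] tendsto_mult_left[OF T[of x], of r] by simp
    have "norm (\<psi> x) \<le> R * norm x"
    proof (rule tendsto_upperbound[OF tendsto_norm[OF T] always_eventually G], rule allI)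
      show "norm (z k \<bullet> x) \<le> R * norm x" for k
        using Cauchy_Schwarz_ineq2[of "z k" x] mult_right_mono[OF bdd[of k] norm_ge_zero[of x]] by simp
    qed
    then show "norm (\<psi> x) \<le> norm x * R" by (simp add: mult.commute)
  qed
  then obtain q where "\<And>y. \<psi> y = q \<bullet> y" using riesz_representation by blast
  with T have "\<forall>y. ((\<lambda>k. z k \<bullet> y) \<longlongrightarrow> q \<bullet> y) G" by simp
  moreover have "G \<le> F" by (simp add: G_def)
  ultimately show ?thesis using G by blast
qed

text \<open>If one functional failed to converge, it would stay at distance \<open>e\<close> on an
  infinite index set \<open>S\<close>. A weakly convergent refinement inside \<open>S\<close> would
  still have limit \<open>q\<close>, a contradiction.\<close>

lemma weakly_tendstoI_cluster:
  fixes z :: "nat \<Rightarrow> 'a::{real_inner, complete_space}"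
  assumes bdd: "\<And>k. norm (z k) \<le> R"
    and cluster: "\<And>G q'. \<lbrakk>G \<noteq> bot; G \<le> sequentially; \<And>y. ((\<lambda>k. z k \<bullet> y) \<longlongrightarrow> q' \<bullet> y) G\<rbrakk> \<Longrightarrow> q' = q"
  shows "weakly_tendsto z q"
  unfolding weakly_tendsto_def
proof (intro allI, rule ccontr)
  fix y assume "\<not> (\<lambda>k. z k \<bullet> y) \<longlonglongrightarrow> q \<bullet> y"
  then obtain e where e: "e > 0" "\<not> (\<forall>\<^sub>F k in sequentially. dist (z k \<bullet> y) (q \<bullet> y) < e)"
    unfolding tendsto_iff by blast
  define S where "S = {k. \<not> dist (z k \<bullet> y) (q \<bullet> y) < e}"
  define F where "F = inf sequentially (principal S)"
  have F: "F \<noteq> bot"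
  proof
    assume "F = bot"
    then have "eventually (\<lambda>_. False) (inf sequentially (principal S))" by (simp add: F_def)
    then show False using e(2) by (simp add: eventually_inf_principal S_def)
  qed
  from bounded_imp_weakly_convergent_subfilter[OF F, of z R] bdd
  obtain G q' where G: "G \<noteq> bot" "G \<le> F" "\<forall>y. ((\<lambda>k. z k \<bullet> y) \<longlongrightarrow> q' \<bullet> y) G" by blast
  have "G \<le> sequentially" using G(2) by (simp add: F_def)
  then have "q' = q" using cluster[OF G(1)] G(3) by blast
  with G(3)[rule_format, of y] e(1) have "\<forall>\<^sub>F k in G. dist (z k \<bullet> y) (q \<bullet> y) < e"
    unfolding tendsto_iff by blast
  moreover have "eventually (\<lambda>k. k \<in> S) G"
    using G(2) by (rule filter_leD) (simp add: F_def eventually_inf_principal)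
  ultimately have "eventually (\<lambda>_. False) G"
    by eventually_elim (simp add: S_def)
  with G(1) show False by (simp add: trivial_limit_def)
qed

subsection \<open>Subgradients and the proximal map\<close>

lemma affine_of_small_quadratic:
  fixes a c :: real
  assumes "\<And>t. \<lbrakk>0 < t; t < 1\<rbrakk> \<Longrightarrow> 0 \<le> a + t * c"
  shows "0 \<le> a"
proof -
  have "((\<lambda>t. a + t * c) \<longlongrightarrow> a + 0 * c) (at_right 0)"
    by (intro tendsto_intros)
  moreover have "eventually (\<lambda>t::real. 0 < t \<and> t < 1) (at_right 0)"
    by (simp add: eventually_at_right_field) (meson zero_less_one)
  then have "eventually (\<lambda>t. 0 \<le> a + t * c) (at_right 0)"
    by eventually_elim (use assms in auto)
  ultimately have "0 \<le> a + 0 * c"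
    by (intro tendsto_lowerbound) auto
  then show ?thesis by simp
qed

text \<open>First-order optimality: compare \<open>p\<close> with \<open>p + t *\<^sub>R d\<close>,
  use convexity of \<open>f\<close>, divide by \<open>t\<close> and let it tend to \<open>0\<close>.
  Only an upper expansion of \<open>\<psi>\<close> enters, and its remainder constant may depend on
  the direction.\<close>

lemma minimizer_imp_subgradient:
  fixes f :: "'a::real_inner \<Rightarrow> ereal"
  assumes f: "proper_fun f" "convex_ereal f"
    and min: "\<And>y. f p + ereal (\<psi> p) \<le> f y + ereal (\<psi> y)"
    and smooth: "\<And>d t. \<lbrakk>0 < t; t < 1\<rbrakk> \<Longrightarrow> \<psi> (p + t *\<^sub>R d) \<le> \<psi> p + t * (g \<bullet> d) + t\<^sup>2 * C d"
  shows "- g \<in> subdifferential f p"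
proof -
  obtain x0 where x0: "f x0 \<noteq> \<infinity>" using f(1) unfolding proper_fun_def by blast
  have not_minf: "f y \<noteq> - \<infinity>" for y using f(1) unfolding proper_fun_def by blast
  have "f p \<noteq> \<infinity>" using min[of x0] x0 not_minf[of x0] by (cases "f x0") auto
  then obtain r where r: "f p = ereal r" using not_minf[of p] by (cases "f p") auto
  have "f p + ereal (- g \<bullet> (y - p)) \<le> f y" for y
  proof (cases "f y")
    case (real s)
    define d where "d = y - p"
    have "0 \<le> (s - r + g \<bullet> d) + t * C d" if t: "0 < t" "t < 1" for t
    proof -
      have eq: "(1 - t) *\<^sub>R p + t *\<^sub>R y = p + t *\<^sub>R d" by (simp add: d_def algebra_simps)
      have "f (p + t *\<^sub>R d) \<le> ereal (1 - t) * f p + ereal t * f y"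
        using f(2) t unfolding convex_ereal_def eq[symmetric] by blast
      then have "f (p + t *\<^sub>R d) \<le> ereal ((1 - t) * r + t * s)" by (simp add: r real)
      then have "f (p + t *\<^sub>R d) + ereal (\<psi> (p + t *\<^sub>R d))
          \<le> ereal ((1 - t) * r + t * s) + ereal (\<psi> p + t * (g \<bullet> d) + t\<^sup>2 * C d)"
        by (rule add_mono) (use smooth[OF t] in simp)
      from order.trans[OF min this]
      have "0 \<le> t * ((s - r + g \<bullet> d) + t * C d)"
        by (simp add: r algebra_simps power2_eq_square)
      then show ?thesis using t by (simp add: zero_le_mult_iff)
    qed
    then have "0 \<le> s - r + g \<bullet> d" by (rule affine_of_small_quadratic)
    then show ?thesis by (simp add: r real d_def)
  qed (use not_minf in auto)
  then show ?thesis by (simp add: subdifferential_def r)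
qed

lemma subdifferentialD:
  assumes "u \<in> subdifferential f x"
  shows "\<bar>f x\<bar> \<noteq> \<infinity>" "f x + ereal (u \<bullet> (y - x)) \<le> f y"
  using assms by (auto simp: subdifferential_def)

lemma subdifferential_monotone:
  assumes "u \<in> subdifferential f x" "v \<in> subdifferential f y"
  shows "0 \<le> (u - v) \<bullet> (x - y)"
  using subdifferentialD(1)[OF assms(1)] subdifferentialD(1)[OF assms(2)]
    subdifferentialD(2)[OF assms(1), of y] subdifferentialD(2)[OF assms(2), of x]
  by (cases "f x"; cases "f y") (auto simp: algebra_simps)

text \<open>\<open>prox\<close> is a choice of minimiser, so existence comes first: the subgradient
  at \<open>x0\<close> is an affine minorant that keeps the regularised function bounded below. The
  optimality condition then gives the claim.\<close>

lemma prox_subgradient: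
  fixes f :: "'a::{real_inner, complete_space} \<Rightarrow> ereal"
  assumes f: "proper_fun f" "convex_ereal f" "lower_semicontinuous f"
    and s: "s \<in> subdifferential f x0" and \<tau>: "\<tau> > 0"
  shows "(1 / \<tau>) *\<^sub>R (x - prox \<tau> f x) \<in> subdifferential f (prox \<tau> f x)"
proof -
  define \<kappa> where "\<kappa> = 1 / (2 * \<tau>)"
  have \<kappa>: "\<kappa> > 0" "2 * \<kappa> = 1 / \<tau>" using \<tau> by (auto simp: \<kappa>_def)
  define \<psi> where "\<psi> u = \<kappa> * (norm (u - x))\<^sup>2" for u
  obtain r0 where r0: "f x0 = ereal r0" using subdifferentialD(1)[OF s] by (cases "f x0") auto
  have \<psi>_mid: "\<psi> ((1/2) *\<^sub>R u + (1/2) *\<^sub>R v) = (\<psi> u + \<psi> v) / 2 - \<kappa> / 4 * (norm (u - v))\<^sup>2" for u v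
    unfolding \<psi>_def norm_midpoint_sq by (simp add: algebra_simps add_divide_distrib)
  have not_minf: "f y \<noteq> - \<infinity>" for y using f(1) unfolding proper_fun_def by blast
  have "\<exists>p. \<forall>u. f p + ereal (\<psi> p) \<le> f u + ereal (\<psi> u)"
  \<comment> \<open>\<open>m\<close> is the minimum over \<open>u\<close> of the affine minorant
    plus \<open>\<psi> u\<close>, found by completing the square.\<close>
  proof (rule uniformly_convex_has_minimizer[where c = "\<kappa> / 4" and w = x0
        and m = "r0 + s \<bullet> (x - x0) - \<tau> / 2 * (norm s)\<^sup>2"])
    fix u c r t assume u: "u \<longlonglongrightarrow> c" and r: "r \<longlonglongrightarrow> t"
      and le: "\<And>n. f (u n) + ereal (\<psi> (u n)) \<le> ereal (r n)"
    have "f (u n) \<le> ereal (r n - \<psi> (u n))" for n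
      using le[of n] by (cases "f (u n)") auto
    moreover have "(\<lambda>n. r n - \<psi> (u n)) \<longlonglongrightarrow> t - \<psi> c"
      unfolding \<psi>_def by (intro tendsto_intros u r)
    ultimately have "f c \<le> ereal (t - \<psi> c)"
      by (intro lower_semicontinuous_seq[OF f(3) u]) auto
    then show "f c + ereal (\<psi> c) \<le> ereal t" by (cases "f c") auto
  next
    fix u
    have "0 \<le> \<kappa> * (norm ((u - x) + \<tau> *\<^sub>R s))\<^sup>2" using \<kappa> by simp
    also have "\<dots> = \<psi> u + (2 * \<kappa> * \<tau>) * (s \<bullet> (u - x)) + (2 * \<kappa> * \<tau>) * \<tau> / 2 * (norm s)\<^sup>2"
      unfolding power2_norm_eq_inner \<psi>_def
      by (simp add: inner_add_left inner_add_right inner_commute power2_eq_square algebra_simps)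
    also have "2 * \<kappa> * \<tau> = 1" using \<tau> by (simp add: \<kappa>_def)
    finally have "r0 + s \<bullet> (x - x0) - \<tau> / 2 * (norm s)\<^sup>2 \<le> (r0 + s \<bullet> (u - x0)) + \<psi> u"
      by (simp add: inner_diff_right)
    then have "ereal (r0 + s \<bullet> (x - x0) - \<tau> / 2 * (norm s)\<^sup>2) \<le> (f x0 + ereal (s \<bullet> (u - x0))) + ereal (\<psi> u)"
      by (simp add: r0)
    also have "\<dots> \<le> f u + ereal (\<psi> u)"
      by (intro add_mono subdifferentialD(2)[OF s] order_refl)
    finally show "ereal (r0 + s \<bullet> (x - x0) - \<tau> / 2 * (norm s)\<^sup>2) \<le> f u + ereal (\<psi> u)" .
  next
    fix u v r t assume "f u + ereal (\<psi> u) \<le> ereal r" "f v + ereal (\<psi> v) \<le> ereal t"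
    then obtain ru rv where ru: "f u = ereal ru" "ru + \<psi> u \<le> r" and rv: "f v = ereal rv" "rv + \<psi> v \<le> t"
      using not_minf[of u] not_minf[of v] by (cases "f u"; cases "f v") auto
    have "f ((1 - 1/2) *\<^sub>R u + (1/2) *\<^sub>R v) \<le> ereal (1 - 1/2) * f u + ereal (1/2) * f v"
      by (rule f(2)[unfolded convex_ereal_def, rule_format]) simp
    then have "f ((1/2) *\<^sub>R u + (1/2) *\<^sub>R v) \<le> ereal ((ru + rv) / 2)"
      by (simp add: ru rv add_divide_distrib)
    then have "f ((1/2) *\<^sub>R u + (1/2) *\<^sub>R v) + ereal (\<psi> ((1/2) *\<^sub>R u + (1/2) *\<^sub>R v))
        \<le> ereal ((ru + rv) / 2) + ereal ((\<psi> u + \<psi> v) / 2 - \<kappa> / 4 * (norm (u - v))\<^sup>2)"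
      unfolding \<psi>_mid by (intro add_mono order_refl)
    also have "\<dots> \<le> ereal ((r + t) / 2 - \<kappa> / 4 * (norm (u - v))\<^sup>2)"
    proof -
      have "(ru + rv) / 2 + (\<psi> u + \<psi> v) / 2 \<le> (r + t) / 2" using ru(2) rv(2) by argo
      then show ?thesis unfolding plus_ereal.simps ereal_less_eq by (simp only: add_diff_eq diff_right_mono)
    qed
    finally show "f ((1/2) *\<^sub>R u + (1/2) *\<^sub>R v) + ereal (\<psi> ((1/2) *\<^sub>R u + (1/2) *\<^sub>R v))
        \<le> ereal ((r + t) / 2 - \<kappa> / 4 * (norm (u - v))\<^sup>2)" .
  next
    show "f x0 + ereal (\<psi> x0) < \<infinity>" by (simp add: r0)
  next
    show "0 < \<kappa> / 4" using \<kappa> by simp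
  qed
  then obtain q where q: "\<And>u. f q + ereal (\<psi> q) \<le> f u + ereal (\<psi> u)" by blast
  define p where "p = prox \<tau> f x"
  \<comment> \<open>Because a minimiser \<open>q\<close> exists, the choice inside
    \<open>prox\<close> also returns one.\<close>
  have "is_arg_min (\<lambda>u. f u + ereal (\<psi> u)) (\<lambda>_. True) p"
    unfolding p_def prox_def arg_min_def \<kappa>_def[symmetric] \<psi>_def[symmetric]
    by (rule someI[of _ q]) (auto simp: is_arg_min_def not_less q)
  then have p: "f p + ereal (\<psi> p) \<le> f u + ereal (\<psi> u)" for u
    by (auto simp: is_arg_min_def not_less)
  have "- ((1 / \<tau>) *\<^sub>R (p - x)) \<in> subdifferential f p"
  proof (rule minimizer_imp_subgradient[OF f(1,2) p, where C = "\<lambda>d. \<kappa> * (norm d)\<^sup>2"])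
    fix d t
    have "(norm (p + t *\<^sub>R d - x))\<^sup>2 = (norm (p - x))\<^sup>2 + 2 * t * ((p - x) \<bullet> d) + t\<^sup>2 * (norm d)\<^sup>2"
      unfolding power2_norm_eq_inner by (simp add: algebra_simps inner_commute power2_eq_square)
    then have "\<psi> (p + t *\<^sub>R d) = \<psi> p + t * (2 * \<kappa> * ((p - x) \<bullet> d)) + t\<^sup>2 * (\<kappa> * (norm d)\<^sup>2)"
      unfolding \<psi>_def by (simp only: distrib_left mult_ac)
    then show "\<psi> (p + t *\<^sub>R d) \<le> \<psi> p + t * ((1 / \<tau>) *\<^sub>R (p - x) \<bullet> d) + t\<^sup>2 * (\<kappa> * (norm d)\<^sup>2)"
      unfolding \<kappa>(2)[symmetric] by simp
  qed
  then show ?thesis unfolding p_def by (simp add: algebra_simps)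
qed

subsection \<open>Convex functions with Lipschitz continuous gradient\<close>

text \<open>\<open>gradient\<close> is a definite description: Riesz turns the derivative into a
  vector, and uniqueness of derivatives makes it the only one.\<close>

lemma gradient_GDERIV:
  fixes h :: "'a::{real_inner, complete_space} \<Rightarrow> real"
  assumes "h differentiable_on UNIV"
  shows "GDERIV h x :> gradient h x"
proof -
  obtain D where D: "(h has_derivative D) (at x)"
    using assms unfolding differentiable_on_def differentiable_def by auto
  obtain p where "\<And>u. D u = p \<bullet> u"
    using riesz_representation[OF has_derivative_bounded_linear[OF D]] by blast
  then have "D = (\<lambda>u. p \<bullet> u)" by blast
  then have p: "GDERIV h x :> p"
    using D unfolding gderiv_def by (simp only: inner_commute[of p])
  moreover have "q = p" if "GDERIV h x :> q" for q
  proof (rule inner_left_unique)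
    fix y show "q \<bullet> y = p \<bullet> y"
      using fun_cong[OF has_derivative_unique[OF that[unfolded gderiv_def] p[unfolded gderiv_def]], of y]
      by (simp add: inner_commute)
  qed
  ultimately show ?thesis unfolding gradient_def by (rule theI[of _ p])
qed

lemma DERIV_along_line:
  fixes h :: "'a::{real_inner, complete_space} \<Rightarrow> real"
  assumes "h differentiable_on UNIV"
  shows "((\<lambda>t. h (x + t *\<^sub>R d)) has_real_derivative gradient h (x + t *\<^sub>R d) \<bullet> d) (at t)"
proof -
  have "((\<lambda>t. x + t *\<^sub>R d) has_derivative (\<lambda>s. s *\<^sub>R d)) (at t)"
    by (auto intro!: derivative_eq_intros)
  from has_derivative_compose[OF this gradient_GDERIV[OF assms, unfolded gderiv_def]]
  show ?thesis by (simp add: has_field_derivative_def inner_commute mult_commute_abs)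
qed

text \<open>On the line through \<open>x\<close> and \<open>y\<close> this is the one-dimensional
  tangent inequality at \<open>0\<close>.\<close>

lemma convex_gradient_ineq:
  fixes h :: "'a::{real_inner, complete_space} \<Rightarrow> real"
  assumes h: "convex_on UNIV h" "h differentiable_on UNIV"
  shows "h x + gradient h x \<bullet> (y - x) \<le> h y"
proof -
  define \<phi> where "\<phi> t = h (x + t *\<^sub>R (y - x))" for t
  have "convex_on UNIV \<phi>"
  proof (rule convex_onI)
    fix t a b :: real assume t: "0 < t" "t < 1"
    have "x + ((1 - t) *\<^sub>R a + t *\<^sub>R b) *\<^sub>R (y - x)
        = (1 - t) *\<^sub>R (x + a *\<^sub>R (y - x)) + t *\<^sub>R (x + b *\<^sub>R (y - x))"
      by (simp add: algebra_simps)
    then show "\<phi> ((1 - t) *\<^sub>R a + t *\<^sub>R b) \<le> (1 - t) * \<phi> a + t * \<phi> b"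
      unfolding \<phi>_def using t by (simp only:) (intro convex_onD[OF h(1)], auto)
  qed simp
  moreover have "(\<phi> has_real_derivative gradient h x \<bullet> (y - x)) (at 0)"
    using DERIV_along_line[OF h(2), of x "y - x" 0] by (simp add: \<phi>_def[abs_def])
  ultimately have "\<phi> 1 - \<phi> 0 \<ge> (gradient h x \<bullet> (y - x)) * (1 - 0)"
    by (intro convex_on_imp_above_tangent[where A = UNIV]) auto
  then show ?thesis by (simp add: \<phi>_def)
qed

text \<open>The quadratic subtracted in \<open>\<phi>\<close> compensates the Lipschitz growth of
  the gradient along the segment, so \<open>\<phi>\<close> has nonpositive derivative there.\<close>

lemma lipschitz_gradient_descent:
  fixes h :: "'a::{real_inner, complete_space} \<Rightarrow> real"
  assumes h: "h differentiable_on UNIV" and L: "L-lipschitz_on UNIV (gradient h)"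
  shows "h (x + d) \<le> h x + gradient h x \<bullet> d + L / 2 * (norm d)\<^sup>2"
proof -
  define \<phi> where "\<phi> t = h (x + t *\<^sub>R d) - t * (gradient h x \<bullet> d) - L / 2 * t\<^sup>2 * (norm d)\<^sup>2" for t
  have "\<phi> 1 \<le> \<phi> 0"
  proof (rule DERIV_nonpos_imp_nonincreasing[of 0 1 \<phi>])
    fix t :: real assume t: "0 \<le> t" "t \<le> 1"
    have "(\<phi> has_real_derivative gradient h (x + t *\<^sub>R d) \<bullet> d - gradient h x \<bullet> d - L * t * (norm d)\<^sup>2) (at t)"
      unfolding \<phi>_def[abs_def] by (auto intro!: derivative_eq_intros DERIV_along_line[OF h])
    moreover have "norm (gradient h (x + t *\<^sub>R d) - gradient h x) \<le> L * (t * norm d)"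
      using lipschitz_onD[OF L, of "x + t *\<^sub>R d" x] t by (simp add: dist_norm)
    then have "norm (gradient h (x + t *\<^sub>R d) - gradient h x) * norm d \<le> L * (t * norm d) * norm d"
      by (rule mult_right_mono) simp
    then have "(gradient h (x + t *\<^sub>R d) - gradient h x) \<bullet> d \<le> L * (t * norm d) * norm d"
      using norm_cauchy_schwarz order.trans by blast
    ultimately show "\<exists>y. (\<phi> has_real_derivative y) (at t) \<and> y \<le> 0"
      by (intro exI conjI) (auto simp: inner_diff_left power2_eq_square mult.assoc)
  qed simp
  then show ?thesis by (simp add: \<phi>_def)
qed

text \<open>The Baillon--Haddad theorem. The function \<open>h - \<nabla>h(x) \<bullet> (\<cdot>)\<close> is minimal at \<open>x\<close>; compare
  its values at \<open>x\<close> and after a gradient step from \<open>y\<close>.\<close>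

lemma gradient_cocoercive:
  fixes h :: "'a::{real_inner, complete_space} \<Rightarrow> real"
  assumes h: "convex_on UNIV h" "h differentiable_on UNIV" and \<beta>: "\<beta> > 0"
    and L: "(1 / \<beta>)-lipschitz_on UNIV (gradient h)"
  shows "\<beta> * (norm (gradient h x - gradient h y))\<^sup>2 \<le> (gradient h x - gradient h y) \<bullet> (x - y)"
proof -
  have *: "\<beta> / 2 * (norm (gradient h y - gradient h x))\<^sup>2 \<le> h y - h x - gradient h x \<bullet> (y - x)" for x y
  proof -
    define g where "g = gradient h y - gradient h x"
    \<comment> \<open>The step length \<open>\<beta>\<close>, the reciprocal of the Lipschitz
      constant, minimises the quadratic upper bound.\<close>
    define z where "z = y + (- \<beta>) *\<^sub>R g"
    have "h x + gradient h x \<bullet> (z - x) \<le> h z" by (rule convex_gradient_ineq[OF h])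
    also have "h z \<le> h y + gradient h y \<bullet> ((- \<beta>) *\<^sub>R g) + 1 / \<beta> / 2 * (norm ((- \<beta>) *\<^sub>R g))\<^sup>2"
      unfolding z_def by (rule lipschitz_gradient_descent[OF h(2) L])
    also have "1 / \<beta> / 2 * (norm ((- \<beta>) *\<^sub>R g))\<^sup>2 = \<beta> / 2 * (norm g)\<^sup>2"
      using \<beta> by (simp add: power_mult_distrib field_simps power2_eq_square)
    finally have "h x + gradient h x \<bullet> (y - x) - \<beta> * (gradient h x \<bullet> g)
        \<le> h y - \<beta> * (gradient h y \<bullet> g) + \<beta> / 2 * (norm g)\<^sup>2"
      by (simp add: z_def inner_diff_right inner_add_right)
    moreover have "(norm g)\<^sup>2 = gradient h y \<bullet> g - gradient h x \<bullet> g"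
      unfolding power2_norm_eq_inner by (subst g_def) (simp add: inner_diff_left)
    then have "\<beta> * (gradient h y \<bullet> g) - \<beta> * (gradient h x \<bullet> g) = \<beta> * (norm g)\<^sup>2"
      by (simp add: right_diff_distrib)
    ultimately show ?thesis unfolding g_def[symmetric] by simp
  qed
  \<comment> \<open>Adding the inequalities for both orders of \<open>x\<close> and \<open>y\<close>
    cancels the function values.\<close>
  show ?thesis
    using *[of x y] *[of y x] by (simp add: norm_minus_commute inner_diff_left inner_diff_right)
qed

subsection \<open>The Lyapunov function of the momentum recursion\<close>

text \<open>The energy computations need only these algebraic properties of the metric; coercivity
  enters later, for the concrete form.\<close>

locale semi_inner =
  fixes B :: "'z::real_vector \<Rightarrow> 'z \<Rightarrow> real"
  assumes add_left: "B (x + y) w = B x w + B y w"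
    and scale_left: "B (r *\<^sub>R x) w = r * B x w"
    and sym: "B x y = B y x"
    and nonneg: "0 \<le> B x x"
begin

lemma add_right: "B w (x + y) = B w x + B w y"
  by (metis add_left sym)

lemma scale_right: "B w (r *\<^sub>R x) = r * B w x"
  by (metis scale_left sym)

lemma minus_left: "B (- x) w = - B x w"
  using scale_left[of "- 1" x w] by simp

lemma minus_right: "B w (- x) = - B w x"
  by (metis minus_left sym)

lemma diff_left: "B (x - y) w = B x w - B y w"
  using add_left[of x "- y" w] by (simp add: minus_left)

lemma diff_right: "B w (x - y) = B w x - B w y"
  by (metis diff_left sym)

lemmas bilinear = add_left add_right scale_left scale_right diff_left diff_right minus_left minus_right

lemma young:
  assumes "c > 0"
  shows "\<bar>B x y\<bar> \<le> (c * B x x + B y y / c) / 2"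
proof -
  have "0 \<le> B (c *\<^sub>R x + y) (c *\<^sub>R x + y)" "0 \<le> B (c *\<^sub>R x - y) (c *\<^sub>R x - y)"
    by (rule nonneg)+
  then have "0 \<le> c * (c * B x x) + 2 * c * B x y + B y y" "0 \<le> c * (c * B x x) - 2 * c * B x y + B y y"
    by (simp_all add: bilinear sym[of y x] algebra_simps)
  with assms show ?thesis by (simp add: field_simps abs_le_iff)
qed

lemma cauchy_schwarz: "(B x y)\<^sup>2 \<le> B x x * B y y"
proof (cases "B y y = 0")
  case True
  have "B x y = 0"
  proof (rule ccontr)
    assume "B x y \<noteq> 0"
    \<comment> \<open>This weight makes \<open>c * B x x\<close> at most
      \<open>\<bar>B x y\<bar>\<close>, so Young's inequality would give
      \<open>\<bar>B x y\<bar>\<close> at most half of itself.\<close>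
    define c where "c = \<bar>B x y\<bar> / (B x x + 1)"
    have pos: "0 < B x x + 1" using nonneg[of x] by linarith
    then have c: "c > 0" using \<open>B x y \<noteq> 0\<close> by (simp add: c_def)
    have "c * B x x \<le> \<bar>B x y\<bar>"
      unfolding c_def using pos nonneg[of x] by (simp add: field_simps mult_left_mono)
    with young[OF c, of x y] True \<open>B x y \<noteq> 0\<close> show False by simp
  qed
  then show ?thesis by (simp add: True)
next
  case False
  then have pos: "B y y > 0" using nonneg[of y] by linarith
  have "0 \<le> B (B y y *\<^sub>R x - B x y *\<^sub>R y) (B y y *\<^sub>R x - B x y *\<^sub>R y)" by (rule nonneg)
  also have "\<dots> = B y y * (B x x * B y y - (B x y)\<^sup>2)"
    by (simp add: bilinear sym[of y x] algebra_simps power2_eq_square)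
  finally show ?thesis using pos by (simp add: zero_le_mult_iff)
qed

lemma square_diff_le: "B (x - y) (x - y) \<le> 2 * B x x + 2 * B y y"
  using young[of 1 x y] by (simp add: bilinear sym[of y x])

lemma square_diff3_le: "B (x - y - w) (x - y - w) \<le> 3 * (B x x + B y y + B w w)"
  using young[of 1 x y] young[of 1 x w] young[of 1 y w]
  by (simp add: bilinear sym[of y x] sym[of w x] sym[of w y])

end

lemma eventually_le_linear:
  fixes c d :: real
  assumes "d > 0"
  shows "\<forall>\<^sub>F k::nat in sequentially. c \<le> d * real k"
proof -
  obtain N :: nat where N: "c / d \<le> real N" using real_arch_simple by blast
  show ?thesis
  proof (rule eventually_sequentiallyI[of N])
    fix k assume "N \<le> k"
    with N have "c / d \<le> real k" by linarith
    with assms show "c \<le> d * real k" by (simp add: field_simps)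
  qed
qed

text \<open>\<open>D k\<close> stands for the functional \<open>\<langle>\<cdot>, C z\<^sub>k - C z\<^sub>k\<^sub>-\<^sub>1\<rangle>\<close> of the cocoercive part \<open>C\<close>
  and \<open>n k\<close> for its squared dual norm; \<open>g k = M\<^sup>-\<^sup>1(t\<^sub>k + C z\<^sub>k\<^sub>-\<^sub>1)\<close> is the residual, measured in
  the metric \<open>B = \<langle>\<cdot>, M \<cdot>\<rangle>\<close>.\<close>

locale momentum = semi_inner B for B :: "'z::real_vector \<Rightarrow> 'z \<Rightarrow> real" +
  fixes z g :: "nat \<Rightarrow> 'z" and D :: "nat \<Rightarrow> 'z \<Rightarrow> real" and n :: "nat \<Rightarrow> real"
    and \<alpha> \<kappa> :: real and zs :: 'z
  assumes \<alpha>: "\<alpha> > 2" and \<kappa>: "\<kappa> > 1 / 2"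
    and recursion: "k \<ge> 1 \<Longrightarrow> (real k + \<alpha>) *\<^sub>R (z (Suc k) - z k)
        = real k *\<^sub>R (z k - z (k - 1)) - (real k + \<alpha>) *\<^sub>R (g (Suc k) - g k) - (\<alpha> / 2) *\<^sub>R g k"
    and D_linear: "linear (D k)"
    and D_bound: "c > 0 \<Longrightarrow> D k w \<le> (c * B w w + n k / c) / 2"
    and n_nonneg: "0 \<le> n k"
    and D_cocoercive: "k \<ge> 1 \<Longrightarrow> \<kappa> * n k \<le> D k (z k - z (k - 1))"
    and D_monotone: "k \<ge> 1 \<Longrightarrow> D k (z (Suc k) - z k) \<le> B (z (Suc k) - z k) (g (Suc k) - g k)"
    and star: "k \<ge> 1 \<Longrightarrow> - (B (z k - z (k - 1)) (z k - z (k - 1)) / (4 * \<kappa>)) \<le> B (z k - zs) (g k)"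
begin

section \<open>The energy and its one-step change\<close>

definition \<Delta> where "\<Delta> k = z k - z (k - 1)"
definition a where "a k = z k - zs"
definition u where "u k = real k *\<^sub>R \<Delta> k"
definition y where "y k = u k + (real k + \<alpha> / 2) *\<^sub>R g k"
definition P where "P k = (B (u k) (u k) + B (y k) (y k)) / 4"
definition Q where "Q k = (\<alpha> - 1) / 2 * B (a k) (a k) + B (a k) (y k)"
text \<open>The dissipation that drives the decrease of the energy.\<close>

definition R where "R k = B (\<Delta> k) (\<Delta> k) + B (g k) (g k)"

lemma R_nonneg: "0 \<le> R k"
  by (simp add: R_def nonneg)

text \<open>The coefficients are regrouped so that the increment of \<open>g\<close> carries the
  weight \<open>k + \<alpha> / 2\<close> that \<open>g k\<close> has in \<open>y k\<close>; adding
  the two then leaves only \<open>g (Suc k)\<close>.\<close>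

lemma recursion':
  assumes "k \<ge> 1"
  shows "u k = (real k + \<alpha>) *\<^sub>R \<Delta> (Suc k) + (real k + \<alpha> / 2) *\<^sub>R (g (Suc k) - g k) + (\<alpha> / 2) *\<^sub>R g (Suc k)"
proof -
  have "u k = (real k + \<alpha>) *\<^sub>R \<Delta> (Suc k) + (real k + \<alpha>) *\<^sub>R (g (Suc k) - g k) + (\<alpha> / 2) *\<^sub>R g k"
    using recursion[OF assms] by (simp add: u_def \<Delta>_def)
  moreover have "(real k + \<alpha>) *\<^sub>R e + (\<alpha> / 2) *\<^sub>R (g' - e) = (real k + \<alpha> / 2) *\<^sub>R e + (\<alpha> / 2) *\<^sub>R g'" for e g' :: 'z
  proof -
    have "(real k + \<alpha>) *\<^sub>R e = (real k + \<alpha> / 2) *\<^sub>R e + (\<alpha> / 2) *\<^sub>R e"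
      by (simp flip: scaleR_add_left)
    then show ?thesis by (simp add: scaleR_diff_right)
  qed
  from this[of "g (Suc k) - g k" "g (Suc k)"] have "(real k + \<alpha>) *\<^sub>R (g (Suc k) - g k) + (\<alpha> / 2) *\<^sub>R g k
      = (real k + \<alpha> / 2) *\<^sub>R (g (Suc k) - g k) + (\<alpha> / 2) *\<^sub>R g (Suc k)"
    by simp
  ultimately show ?thesis by (simp add: add.assoc)
qed

text \<open>The weights growing with \<open>k\<close> cancel, so \<open>y\<close> changes only by
  terms with constant coefficients.\<close>

lemma y_step:
  assumes "k \<ge> 1"
  shows "y k = y (Suc k) + (\<alpha> - 1) *\<^sub>R \<Delta> (Suc k) + (\<alpha> / 2 - 1) *\<^sub>R g (Suc k)"
  unfolding y_def recursion'[OF assms] u_def[of "Suc k"]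
  by (simp add: algebra_simps)

text \<open>The factor \<open>(\<alpha> - 1) / 2\<close> is chosen so that the products of
  \<open>a\<close> and \<open>\<Delta>\<close> cancel. The only term left that involves
  \<open>a\<close> is its product with \<open>g\<close>, which \<open>star\<close> controls.\<close>

lemma Q_step:
  assumes "k \<ge> 1"
  defines "p \<equiv> B (\<Delta> (Suc k)) (\<Delta> (Suc k))" and "q \<equiv> B (\<Delta> (Suc k)) (g (Suc k))"
  shows "Q (Suc k) - Q k = - (\<alpha> / 2 - 1) * B (a (Suc k)) (g (Suc k))
    + (real k + (\<alpha> + 1) / 2) * p + (real k + \<alpha>) * q"
proof -
  have ak: "a k = a (Suc k) - \<Delta> (Suc k)" by (simp add: a_def \<Delta>_def)
  show ?thesis
    unfolding Q_def ak y_step[OF assms(1)]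
    unfolding y_def[of "Suc k"] u_def
    by (simp add: bilinear p_def q_def sym[of "\<Delta> (Suc k)" "a (Suc k)"] field_simps)
qed

text \<open>Everything is expanded in \<open>\<Delta> (Suc k)\<close>, \<open>g (Suc k)\<close> and
  the increment \<open>e\<close>. Only \<open>B e e\<close> and the product of
  \<open>\<Delta> (Suc k)\<close> with \<open>e\<close> keep coefficients quadratic in
  \<open>k\<close>; the first helps, the second needs monotonicity.\<close>

lemma P_step:
  assumes "k \<ge> 1"
  defines "p \<equiv> B (\<Delta> (Suc k)) (\<Delta> (Suc k))" and "q \<equiv> B (\<Delta> (Suc k)) (g (Suc k))"
    and "r \<equiv> B (g (Suc k)) (g (Suc k))" and "e \<equiv> g (Suc k) - g k" and "K \<equiv> real k + \<alpha> / 2"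
  shows "P (Suc k) - P k = - (\<alpha> - 1) * (real k + (\<alpha> + 1) / 2) * p
    + ((\<alpha> - 1) * (\<alpha> - 2) / 4 - (\<alpha> - 1) * (real k + \<alpha>)) * q
    - ((\<alpha> - 2) / 4 * (real k + 1 + \<alpha> / 2) + (\<alpha>\<^sup>2 + (\<alpha> - 2)\<^sup>2) / 16) * r
    - K\<^sup>2 / 4 * B e e - K * (real k + \<alpha>) / 2 * B (\<Delta> (Suc k)) e - \<alpha> / 4 * K * B e (g (Suc k))"
proof -
  define d G where "d = \<Delta> (Suc k)" and "G = g (Suc k)"
  have uk: "u k = (real k + \<alpha>) *\<^sub>R d + K *\<^sub>R e + (\<alpha> / 2) *\<^sub>R G"
    unfolding d_def G_def e_def K_def by (rule recursion'[OF assms(1)])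
  have y1: "y (Suc k) = (real k + 1) *\<^sub>R d + (real k + 1 + \<alpha> / 2) *\<^sub>R G"
    by (simp add: y_def u_def d_def G_def add_ac)
  have yk: "y k = (real k + \<alpha>) *\<^sub>R d + (real k + \<alpha>) *\<^sub>R G"
    unfolding y_step[OF assms(1)] y1 d_def[symmetric] G_def[symmetric]
    by (simp add: algebra_simps) (metis add.commute field_sum_of_halves scaleR_add_left)
  have u1: "u (Suc k) = (real k + 1) *\<^sub>R d"
    by (simp add: u_def d_def add_ac)
  show ?thesis
    unfolding P_def uk yk y1 u1 p_def q_def r_def d_def[symmetric] G_def[symmetric]
    unfolding bilinear sym[of G d] sym[of G e] sym[of e d]
    by (simp add: K_def field_simps power2_eq_square)
qed


text \<open>\<open>D_monotone\<close> passes from the cross term to \<open>D k\<close>, and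
  \<open>recursion'\<close> expresses its argument through the previous step, where cocoercivity
  yields a positive multiple of \<open>n k\<close>. Young's inequality with free weights
  \<open>\<rho>\<close> and \<open>T\<close> handles the rest.\<close>

lemma monotone_cross_bound:
  assumes k: "k \<ge> 1" and T: "T > 0" and \<rho>: "\<rho> > 0"
  defines "e \<equiv> g (Suc k) - g k" and "K \<equiv> real k + \<alpha> / 2"
  shows "K * (\<kappa> * real k - K * (1 / (2 * \<rho>) + \<alpha> / (4 * T))) * n k
      - K\<^sup>2 * (\<rho> / 2) * B e e - \<alpha> * T / 4 * B (g (Suc k)) (g (Suc k))
    \<le> K * (real k + \<alpha>) * B (\<Delta> (Suc k)) e"
proof -
  have K: "K > 0" using k \<alpha> by (simp add: K_def)
  interpret D: linear "D k" by (rule D_linear)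
  have "(real k + \<alpha>) * B (\<Delta> (Suc k)) e \<ge> (real k + \<alpha>) * D k (\<Delta> (Suc k))"
    using D_monotone[OF k] \<alpha> by (intro mult_left_mono) (auto simp: \<Delta>_def e_def)
  moreover have "(real k + \<alpha>) * D k (\<Delta> (Suc k)) = D k (u k - K *\<^sub>R e - (\<alpha> / 2) *\<^sub>R g (Suc k))"
    unfolding recursion'[OF k] e_def K_def by (simp add: D.scaleR)
  moreover have "\<dots> = real k * D k (\<Delta> k) - K * D k e - \<alpha> / 2 * D k (g (Suc k))"
    by (simp add: D.diff D.scaleR u_def)
  moreover have "real k * (\<kappa> * n k) \<le> real k * D k (\<Delta> k)"
    using D_cocoercive[OF k] by (intro mult_left_mono) (auto simp: \<Delta>_def)
  moreover have "K * D k e \<le> K * ((\<rho> * B e e + n k / \<rho>) / 2)"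
    using K by (intro mult_left_mono D_bound[OF \<rho>]) auto
  \<comment> \<open>The weight \<open>T / K\<close> leaves a constant coefficient on the square of
    \<open>g (Suc k)\<close> after the later multiplication by \<open>K\<close>.\<close>
  moreover have "\<alpha> / 2 * D k (g (Suc k)) \<le> \<alpha> / 2 * ((T / K * B (g (Suc k)) (g (Suc k)) + n k / (T / K)) / 2)"
    using K T \<alpha> by (intro mult_left_mono D_bound) auto
  ultimately have "real k * (\<kappa> * n k) - K * ((\<rho> * B e e + n k / \<rho>) / 2)
      - \<alpha> / 2 * ((T / K * B (g (Suc k)) (g (Suc k)) + n k / (T / K)) / 2)
      \<le> (real k + \<alpha>) * B (\<Delta> (Suc k)) e"
    by linarith
  from mult_left_mono[OF this, of K]
  have "K * (real k * (\<kappa> * n k) - K * ((\<rho> * B e e + n k / \<rho>) / 2)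
      - \<alpha> / 2 * ((T / K * B (g (Suc k)) (g (Suc k)) + n k / (T / K)) / 2))
      \<le> K * (real k + \<alpha>) * B (\<Delta> (Suc k)) e"
    using K by (simp add: mult.assoc)
  moreover have "K * (real k * (\<kappa> * n k) - K * ((\<rho> * B e e + n k / \<rho>) / 2)
      - \<alpha> / 2 * ((T / K * B (g (Suc k)) (g (Suc k)) + n k / (T / K)) / 2))
    = K * (\<kappa> * real k - K * (1 / (2 * \<rho>) + \<alpha> / (4 * T))) * n k
      - K\<^sup>2 * (\<rho> / 2) * B e e - \<alpha> * T / 4 * B (g (Suc k)) (g (Suc k))"
    using K T \<rho> by (simp add: field_simps power2_eq_square)
  ultimately show ?thesis by simp
qed

definition E where "E \<mu> k = P k + \<mu> * Q k"

text \<open>The available \<open>K\<^sup>2 / 4 * B e e\<close> is split: the share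
  \<open>\<rho>\<close> pays for the monotone cross term, the share \<open>1 - \<rho>\<close> for
  the product of \<open>e\<close> with \<open>g (Suc k)\<close>. The weight \<open>c\<close> splits
  the mixed term in \<open>\<Delta>\<close> and \<open>g\<close>, and \<open>large\<close> makes the
  coefficient of \<open>n k\<close> nonnegative.\<close>

lemma E_step:
  assumes k: "k \<ge> 1" and T: "T > 0" and \<rho>: "0 < \<rho>" "\<rho> < 1" and c: "c > 0"
    and \<mu>: "1 < \<mu>" "\<mu> < \<alpha> - 1"
  defines "\<omega> \<equiv> \<alpha> - 1 - \<mu>"
  assumes large: "real k * \<kappa> \<ge> (real k + \<alpha> / 2) * (1 / (2 * \<rho>) + \<alpha> / (4 * T))"
  shows "E \<mu> (Suc k) - E \<mu> k \<le>
      - (\<omega> * (1 - c / 2) * real k - ((\<omega> * \<alpha> + (\<alpha> - 1) * (\<alpha> - 2) / 4) * c / 2 + \<mu> * (\<alpha> / 2 - 1) / (4 * \<kappa>)))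
          * B (\<Delta> (Suc k)) (\<Delta> (Suc k))
      - (((\<alpha> - 2) / 4 - \<omega> / (2 * c)) * real k
          - ((\<omega> * \<alpha> + (\<alpha> - 1) * (\<alpha> - 2) / 4) / (2 * c) + \<alpha> * T / 8 + \<alpha>\<^sup>2 / (16 * (1 - \<rho>))))
          * B (g (Suc k)) (g (Suc k))"
proof -
  define K where "K = real k + \<alpha> / 2"
  define e where "e = g (Suc k) - g k"
  define p q r ee s j ag where "p = B (\<Delta> (Suc k)) (\<Delta> (Suc k))" and "q = B (\<Delta> (Suc k)) (g (Suc k))"
    and "r = B (g (Suc k)) (g (Suc k))" and "ee = B e e" and "s = B e (g (Suc k))"
    and "j = B (\<Delta> (Suc k)) e" and "ag = B (a (Suc k)) (g (Suc k))"
  have nn: "0 \<le> p" "0 \<le> r" "0 \<le> ee" by (simp_all add: p_def r_def ee_def nonneg)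
  have K: "K > 0" using k \<alpha> by (simp add: K_def)
  have \<omega>: "\<omega> > 0" using \<mu> by (simp add: \<omega>_def)
  define H where "H = \<omega> * \<alpha> + (\<alpha> - 1) * (\<alpha> - 2) / 4"
  \<comment> \<open>\<open>W\<close> dominates the absolute value of the coefficient of
    \<open>q\<close>.\<close>
  define W where "W = \<omega> * real k + H"
  have EE: "E \<mu> (Suc k) - E \<mu> k = - \<omega> * (real k + (\<alpha> + 1) / 2) * p
    + ((\<alpha> - 1) * (\<alpha> - 2) / 4 - \<omega> * (real k + \<alpha>)) * q
    - ((\<alpha> - 2) / 4 * (real k + 1 + \<alpha> / 2) + (\<alpha>\<^sup>2 + (\<alpha> - 2)\<^sup>2) / 16) * r
    - K\<^sup>2 / 4 * ee - K * (real k + \<alpha>) / 2 * j - \<alpha> / 4 * K * s - \<mu> * (\<alpha> / 2 - 1) * ag"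
  proof -
    have "E \<mu> (Suc k) - E \<mu> k = (P (Suc k) - P k) + \<mu> * (Q (Suc k) - Q k)"
      by (simp add: E_def algebra_simps)
    moreover have "(- (\<alpha> - 1) * X * p + (c0 - (\<alpha> - 1) * Y) * q - Z * r - ee1 - j1 - s1)
        + \<mu> * (- (\<alpha> / 2 - 1) * ag + X * p + Y * q)
      = - (\<alpha> - 1 - \<mu>) * X * p + (c0 - (\<alpha> - 1 - \<mu>) * Y) * q - Z * r - ee1 - j1 - s1 - \<mu> * (\<alpha> / 2 - 1) * ag"
      for X Y Z c0 ee1 j1 s1 by (simp add: algebra_simps)
    ultimately show ?thesis
      unfolding P_step[OF k] Q_step[OF k] \<omega>_def K_def p_def q_def r_def e_def ee_def s_def j_def ag_def
      by (rule trans)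
  qed
  have 1: "- \<omega> * (real k + (\<alpha> + 1) / 2) * p \<le> - \<omega> * real k * p"
    using \<omega> \<alpha> nn by (simp add: mult_left_mono mult_right_mono)
  have 2: "((\<alpha> - 1) * (\<alpha> - 2) / 4 - \<omega> * (real k + \<alpha>)) * q \<le> W * ((c * p + r / c) / 2)"
  proof -
    have c0: "0 \<le> (\<alpha> - 1) * (\<alpha> - 2) / 4" "0 \<le> \<omega> * (real k + \<alpha>)" using \<alpha> \<omega> by auto
    have "\<bar>((\<alpha> - 1) * (\<alpha> - 2) / 4 - \<omega> * (real k + \<alpha>)) * q\<bar> \<le> W * \<bar>q\<bar>"
      unfolding abs_mult
    proof (rule mult_right_mono)
      have "\<bar>(\<alpha> - 1) * (\<alpha> - 2) / 4 - \<omega> * (real k + \<alpha>)\<bar> \<le> (\<alpha> - 1) * (\<alpha> - 2) / 4 + \<omega> * (real k + \<alpha>)"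
        using c0 by linarith
      also have "\<dots> = W" by (simp add: W_def H_def algebra_simps)
      finally show "\<bar>(\<alpha> - 1) * (\<alpha> - 2) / 4 - \<omega> * (real k + \<alpha>)\<bar> \<le> W" .
    qed simp
    also have "\<dots> \<le> W * ((c * p + r / c) / 2)"
    proof (rule mult_left_mono)
      show "\<bar>q\<bar> \<le> (c * p + r / c) / 2" unfolding q_def p_def r_def by (rule young[OF c])
      show "0 \<le> W" using c0 \<omega> \<alpha> by (simp add: W_def H_def)
    qed
    finally show ?thesis by linarith
  qed
  have 3: "- (((\<alpha> - 2) / 4 * (real k + 1 + \<alpha> / 2) + (\<alpha>\<^sup>2 + (\<alpha> - 2)\<^sup>2) / 16) * r) \<le> - ((\<alpha> - 2) / 4 * real k * r)"
    unfolding neg_le_iff_le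
  proof (rule mult_right_mono)
    have "(\<alpha> - 2) / 4 * real k \<le> (\<alpha> - 2) / 4 * (real k + 1 + \<alpha> / 2)"
      using \<alpha> by (intro mult_left_mono) auto
    moreover have "0 \<le> (\<alpha>\<^sup>2 + (\<alpha> - 2)\<^sup>2) / 16" by simp
    ultimately show "(\<alpha> - 2) / 4 * real k \<le> (\<alpha> - 2) / 4 * (real k + 1 + \<alpha> / 2) + (\<alpha>\<^sup>2 + (\<alpha> - 2)\<^sup>2) / 16"
      by linarith
  qed (rule nn)
  have 4: "- (K * (real k + \<alpha>) * j) \<le> K\<^sup>2 * (\<rho> / 2) * ee + \<alpha> * T / 4 * r"
  proof -
    have "0 \<le> K * (\<kappa> * real k - K * (1 / (2 * \<rho>) + \<alpha> / (4 * T))) * n k"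
      using K large n_nonneg by (intro mult_nonneg_nonneg) (auto simp: K_def mult.commute)
    with monotone_cross_bound[OF k T \<rho>(1)] show ?thesis
      unfolding K_def e_def ee_def j_def r_def by linarith
  qed
  have 5: "- (\<alpha> / 4 * K * s) \<le> (1 - \<rho>) / 4 * K\<^sup>2 * ee + \<alpha>\<^sup>2 / (16 * (1 - \<rho>)) * r"
  proof -
    \<comment> \<open>Taking \<open>t\<close> proportional to \<open>K\<close> uses exactly the
      share \<open>1 - \<rho>\<close> and leaves a constant coefficient on \<open>r\<close>.\<close>
    define t where "t = 2 * (1 - \<rho>) * K / \<alpha>"
    have t: "t > 0" using \<rho> K \<alpha> by (simp add: t_def)
    have "- s \<le> (t * ee + r / t) / 2"
      using young[OF t, of e "g (Suc k)"] unfolding s_def ee_def r_def by linarith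
    then have "\<alpha> / 4 * K * (- s) \<le> \<alpha> / 4 * K * ((t * ee + r / t) / 2)"
      using K \<alpha> by (intro mult_left_mono) auto
    also have "\<dots> = (1 - \<rho>) / 4 * K\<^sup>2 * ee + \<alpha>\<^sup>2 / (16 * (1 - \<rho>)) * r"
      using K \<alpha> \<rho> by (simp add: t_def field_simps power2_eq_square)
    finally show ?thesis by simp
  qed
  \<comment> \<open>The delayed gradient can make \<open>ag\<close> negative, but by
    \<open>star\<close> only to the extent of a multiple of \<open>p\<close>.\<close>
  have 6: "- (\<mu> * (\<alpha> / 2 - 1) * ag) \<le> \<mu> * (\<alpha> / 2 - 1) / (4 * \<kappa>) * p"
  proof -
    have "\<mu> * (\<alpha> / 2 - 1) * (- ag) \<le> \<mu> * (\<alpha> / 2 - 1) * (p / (4 * \<kappa>))"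
      using star[of "Suc k"] \<mu> \<alpha> by (intro mult_left_mono) (auto simp: ag_def p_def a_def \<Delta>_def)
    then show ?thesis by simp
  qed
  \<comment> \<open>The shares \<open>\<rho> / 4\<close> and \<open>(1 - \<rho>) / 4\<close>
    together exhaust the coefficient of \<open>ee\<close>.\<close>
  have 45: "- (K\<^sup>2 / 4 * ee) - K * (real k + \<alpha>) / 2 * j - \<alpha> / 4 * K * s
      \<le> \<alpha> * T / 8 * r + \<alpha>\<^sup>2 / (16 * (1 - \<rho>)) * r"
  proof -
    have "- (K * (real k + \<alpha>) / 2 * j) = - (K * (real k + \<alpha>) * j) / 2" by simp
    also have "\<dots> \<le> (K\<^sup>2 * (\<rho> / 2) * ee + \<alpha> * T / 4 * r) / 2"
      by (rule divide_right_mono[OF 4]) simp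
    also have "\<dots> = K\<^sup>2 * (\<rho> / 4) * ee + \<alpha> * T / 8 * r"
      by (simp add: add_divide_distrib)
    finally have "- (K * (real k + \<alpha>) / 2 * j) \<le> K\<^sup>2 * (\<rho> / 4) * ee + \<alpha> * T / 8 * r" .
    moreover have "(1 - \<rho>) / 4 * K\<^sup>2 * ee = K\<^sup>2 / 4 * ee - K\<^sup>2 * (\<rho> / 4) * ee"
      by (simp add: algebra_simps diff_divide_distrib)
    ultimately show ?thesis using 5 by linarith
  qed
  have sum_bound: "x \<le> A' + B' + C' + D' + F'"
    if "x = A + B - C - d1 - d2 - d3 - F" "A \<le> A'" "B \<le> B'" "- C \<le> C'" "- d1 - d2 - d3 \<le> D'" "- F \<le> F'"
    for x A A' B B' C C' d1 d2 d3 D' F F' :: real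
    using that by linarith
  have "E \<mu> (Suc k) - E \<mu> k \<le> - \<omega> * real k * p + W * ((c * p + r / c) / 2) - ((\<alpha> - 2) / 4 * real k) * r
      + (\<alpha> * T / 8 * r + \<alpha>\<^sup>2 / (16 * (1 - \<rho>)) * r) + \<mu> * (\<alpha> / 2 - 1) / (4 * \<kappa>) * p"
    using sum_bound[OF EE 1 2 3 45 6] by simp
  also have "\<dots> = - (\<omega> * (1 - c / 2) * real k - ((\<omega> * \<alpha> + (\<alpha> - 1) * (\<alpha> - 2) / 4) * c / 2 + \<mu> * (\<alpha> / 2 - 1) / (4 * \<kappa>)))
          * p - (((\<alpha> - 2) / 4 - \<omega> / (2 * c)) * real k
          - ((\<omega> * \<alpha> + (\<alpha> - 1) * (\<alpha> - 2) / 4) / (2 * c) + \<alpha> * T / 8 + \<alpha>\<^sup>2 / (16 * (1 - \<rho>)))) * r"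
    unfolding W_def H_def[symmetric] by (simp add: algebra_simps add_divide_distrib)
  finally show ?thesis unfolding p_def r_def .
qed

section \<open>Eventual descent and positivity of the energy\<close>

lemma E_descent:
  assumes \<mu>: "1 < \<mu>" "\<mu> < \<alpha> - 1"
  shows "\<exists>\<delta>>0. \<forall>\<^sub>F k in sequentially. E \<mu> (Suc k) \<le> E \<mu> k - \<delta> * (real k * R (Suc k))"
proof -
  define \<omega> where "\<omega> = \<alpha> - 1 - \<mu>"
  \<comment> \<open>From \<open>\<kappa> > 1 / 2\<close>, this gives both \<open>\<rho> < 1\<close>
    and \<open>1 / (2 * \<rho>) < \<kappa>\<close>. \<open>T\<close> then puts
    \<open>\<theta>\<close> halfway between these last two numbers, so the condition
    \<open>large\<close> holds for big \<open>k\<close>.\<close>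
  define \<rho> where "\<rho> = 1 / (\<kappa> + 1 / 2)"
  define T where "T = \<alpha> / (2 * (\<kappa> - 1 / (2 * \<rho>)))"
  define \<theta> where "\<theta> = 1 / (2 * \<rho>) + \<alpha> / (4 * T)"
  \<comment> \<open>Since \<open>0 < \<eta> < 1\<close>, the weight \<open>c = 1 + \<eta>\<close>
    lies strictly between \<open>2 * \<eta>\<close> and \<open>2\<close>: the lower bound makes
    \<open>A2\<close> positive, the upper one \<open>A1\<close>.\<close>
  define \<eta> where "\<eta> = \<omega> / (\<alpha> - 2)"
  define c where "c = 1 + \<eta>"
  have \<omega>: "0 < \<omega>" "\<omega> < \<alpha> - 2" using \<mu> by (auto simp: \<omega>_def)
  have \<rho>: "0 < \<rho>" "\<rho> < 1" "1 / (2 * \<rho>) < \<kappa>" using \<kappa> by (auto simp: \<rho>_def field_simps)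
  have T: "T > 0" using \<rho>(3) \<alpha> by (simp add: T_def)
  have "\<alpha> / (4 * T) = (\<kappa> - 1 / (2 * \<rho>)) / 2" using \<alpha> \<rho>(3) by (simp add: T_def)
  then have \<theta>: "0 < \<kappa> - \<theta>" using \<rho>(3) by (simp add: \<theta>_def field_simps)
  have \<eta>: "0 < \<eta>" "\<eta> < 1" "\<omega> = \<eta> * (\<alpha> - 2)" using \<omega> by (auto simp: \<eta>_def)
  have c: "c > 0" "c < 2" "2 * \<eta> < c" using \<eta>(1,2) by (auto simp: c_def)
  define A1 where "A1 = \<omega> * (1 - c / 2)"
  define A2 where "A2 = (\<alpha> - 2) / 4 - \<omega> / (2 * c)"
  have "A1 > 0" using c \<omega> by (simp add: A1_def)
  moreover have "A2 = (\<alpha> - 2) * (c - 2 * \<eta>) / (4 * c)"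
    unfolding A2_def \<eta>(3) using c(1) by (simp add: field_simps)
  then have "A2 > 0" using c \<alpha> by simp
  ultimately have A: "A1 > 0" "A2 > 0" by auto
  \<comment> \<open>Halving the smaller rate leaves linear slack that eventually absorbs the
    constants \<open>C1\<close> and \<open>C2\<close>.\<close>
  define \<delta> where "\<delta> = min A1 A2 / 2"
  have \<delta>: "\<delta> > 0" "0 < A1 - \<delta>" "0 < A2 - \<delta>" using A by (auto simp: \<delta>_def)
  define C1 where "C1 = (\<omega> * \<alpha> + (\<alpha> - 1) * (\<alpha> - 2) / 4) * c / 2 + \<mu> * (\<alpha> / 2 - 1) / (4 * \<kappa>)"
  define C2 where "C2 = (\<omega> * \<alpha> + (\<alpha> - 1) * (\<alpha> - 2) / 4) / (2 * c) + \<alpha> * T / 8 + \<alpha>\<^sup>2 / (16 * (1 - \<rho>))"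
  have "\<forall>\<^sub>F k in sequentially. E \<mu> (Suc k) \<le> E \<mu> k - \<delta> * (real k * R (Suc k))"
    using eventually_ge_at_top[of 1] eventually_le_linear[OF \<delta>(2), of C1] eventually_le_linear[OF \<delta>(3), of C2]
      eventually_le_linear[OF \<theta>, of "\<alpha> / 2 * \<theta>"]
  proof eventually_elim
    case (elim k)
    have "real k * \<kappa> \<ge> (real k + \<alpha> / 2) * (1 / (2 * \<rho>) + \<alpha> / (4 * T))"
      using elim(4) unfolding \<theta>_def[symmetric] by (simp add: algebra_simps)
    from E_step[OF elim(1) T \<rho>(1,2) c(1) \<mu> this, folded \<omega>_def, folded A1_def A2_def C1_def C2_def]
    have "E \<mu> (Suc k) - E \<mu> k \<le> - (A1 * real k - C1) * B (\<Delta> (Suc k)) (\<Delta> (Suc k))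
        - (A2 * real k - C2) * B (g (Suc k)) (g (Suc k))" .
    also have "\<dots> \<le> - (\<delta> * real k) * B (\<Delta> (Suc k)) (\<Delta> (Suc k)) - (\<delta> * real k) * B (g (Suc k)) (g (Suc k))"
    proof -
      have "\<delta> * real k \<le> A1 * real k - C1" "\<delta> * real k \<le> A2 * real k - C2"
        using elim(2,3) by (simp_all add: algebra_simps)
      note this(1)[THEN mult_right_mono, OF nonneg[of "\<Delta> (Suc k)"]] this(2)[THEN mult_right_mono, OF nonneg[of "g (Suc k)"]]
      then show ?thesis unfolding mult_minus_left by (intro diff_mono) simp_all
    qed
    finally show ?case by (simp add: R_def algebra_simps)
  qed
  with \<delta>(1) show ?thesis by blast
qed

lemma E_lower:
  assumes \<mu>: "1 < \<mu>" "\<mu> < \<alpha> - 1"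
  shows "\<forall>\<^sub>F k in sequentially. \<mu> * (\<alpha> - 1 - \<mu>) / 4 * B (a k) (a k) \<le> E \<mu> k"
proof -
  define \<omega> where "\<omega> = \<alpha> - 1 - \<mu>"
  define s where "s k = (real k + \<alpha> / 2) *\<^sub>R g k" for k
  have \<omega>: "\<omega> > 0" using \<mu> by (simp add: \<omega>_def)
  \<comment> \<open>After this completion of squares only the product of \<open>a k\<close> and
    \<open>s k\<close> has indefinite sign.\<close>
  have eq: "E \<mu> k = B (u k + (1/2) *\<^sub>R s k + \<mu> *\<^sub>R a k) (u k + (1/2) *\<^sub>R s k + \<mu> *\<^sub>R a k) / 2
      + \<mu> * \<omega> / 2 * B (a k) (a k) + B (s k) (s k) / 8 + \<mu> / 2 * B (a k) (s k)" for k
    unfolding E_def P_def Q_def y_def s_def[symmetric] \<omega>_def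
    by (simp add: bilinear sym[of "s k" "u k"] sym[of "a k" "u k"] sym[of "a k" "s k"] field_simps)
  \<comment> \<open>\<open>star\<close> bounds the indefinite term below by
    \<open>- \<theta> k\<close> times the square of \<open>u k\<close>, and
    \<open>\<theta> k\<close> tends to \<open>0\<close>. Writing \<open>u k\<close> through the
    three squares in \<open>eq\<close> lets them absorb it; the factor \<open>3\<close> from
    \<open>square_diff3_le\<close> explains the thresholds \<open>1 / 6\<close> and
    \<open>\<omega> / (12 * \<mu>)\<close>.\<close>
  define \<theta> where "\<theta> k = \<mu> / 2 * (real k + \<alpha> / 2) / (4 * \<kappa> * (real k)\<^sup>2)" for k
  have "(\<lambda>k. \<mu> / (8 * \<kappa>) * (1 / real k + \<alpha> / 2 * (1 / real k * (1 / real k)))) \<longlonglongrightarrow> \<mu> / (8 * \<kappa>) * (0 + \<alpha> / 2 * (0 * 0))"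
    by (intro tendsto_intros lim_1_over_n)
  then have "(\<lambda>k. \<mu> / (8 * \<kappa>) * (1 / real k + \<alpha> / 2 * (1 / real k * (1 / real k)))) \<longlonglongrightarrow> 0" by simp
  moreover have "\<forall>\<^sub>F k in sequentially. \<mu> / (8 * \<kappa>) * (1 / real k + \<alpha> / 2 * (1 / real k * (1 / real k))) = \<theta> k"
    using eventually_gt_at_top[of 0]
    by eventually_elim (use \<kappa> in \<open>simp add: \<theta>_def field_simps power2_eq_square\<close>)
  ultimately have \<theta>: "\<theta> \<longlonglongrightarrow> 0" by (rule Lim_transform_eventually)
  have "\<forall>\<^sub>F k in sequentially. \<theta> k < 1 / 6" "\<forall>\<^sub>F k in sequentially. \<theta> k < \<omega> / (12 * \<mu>)"
    using order_tendstoD(2)[OF \<theta>, of "1 / 6"] order_tendstoD(2)[OF \<theta>, of "\<omega> / (12 * \<mu>)"] \<omega> \<mu>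
    by auto
  then show ?thesis using eventually_ge_at_top[of 1]
  proof eventually_elim
    case (elim k)
    define m where "m = u k + (1/2) *\<^sub>R s k + \<mu> *\<^sub>R a k"
    have \<theta>0: "0 \<le> \<theta> k" using \<mu> \<alpha> \<kappa> by (simp add: \<theta>_def)
    have uk: "u k = m - \<mu> *\<^sub>R a k - (1/2) *\<^sub>R s k" by (simp add: m_def)
    have "B (u k) (u k) \<le> 3 * (B m m + \<mu>\<^sup>2 * B (a k) (a k) + B (s k) (s k) / 4)"
      using square_diff3_le[of m "\<mu> *\<^sub>R a k" "(1/2) *\<^sub>R s k"] unfolding uk[symmetric]
      by (simp add: bilinear power2_eq_square)
    then have "\<theta> k * B (u k) (u k) \<le> \<theta> k * (3 * (B m m + \<mu>\<^sup>2 * B (a k) (a k) + B (s k) (s k) / 4))"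
      using \<theta>0 by (rule mult_left_mono)
    moreover have "- (\<theta> k * B (u k) (u k)) \<le> \<mu> / 2 * B (a k) (s k)"
    proof -
      have "\<mu> / 2 * (real k + \<alpha> / 2) * - (B (\<Delta> k) (\<Delta> k) / (4 * \<kappa>)) \<le> \<mu> / 2 * (real k + \<alpha> / 2) * B (a k) (g k)"
        using star[OF elim(3)] \<mu> \<alpha> by (intro mult_left_mono) (auto simp: \<Delta>_def a_def)
      moreover have "\<theta> k * B (u k) (u k) = \<mu> / 2 * (real k + \<alpha> / 2) * (B (\<Delta> k) (\<Delta> k) / (4 * \<kappa>))"
        using elim(3) by (simp add: \<theta>_def u_def bilinear power2_eq_square)
      ultimately show ?thesis by (simp add: s_def bilinear)
    qed
    moreover have "\<theta> k * 3 * B m m \<le> 1 / 2 * B m m"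
      using elim(1) by (intro mult_right_mono nonneg) simp
    moreover have "\<theta> k * 3 * \<mu>\<^sup>2 * B (a k) (a k) \<le> \<mu> * \<omega> / 4 * B (a k) (a k)"
      using elim(2) \<mu> by (intro mult_right_mono nonneg) (simp add: field_simps power2_eq_square)
    moreover have "\<theta> k * 3 / 4 * B (s k) (s k) \<le> 1 / 8 * B (s k) (s k)"
      using elim(1) by (intro mult_right_mono nonneg) simp
    ultimately have "\<mu> * \<omega> / 4 * B (a k) (a k) \<le> B m m / 2 + \<mu> * \<omega> / 2 * B (a k) (a k) + B (s k) (s k) / 8 + \<mu> / 2 * B (a k) (s k)"
      by (simp add: field_simps)
    then show ?case unfolding eq m_def \<omega>_def .
  qed
qed


lemma P_le: "\<exists>C>0. \<forall>k\<ge>1. P k \<le> C * (real k * (real k * R k))"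
proof (intro exI[of _ "1 + \<alpha>\<^sup>2"] conjI allI impI)
  show "0 < 1 + \<alpha>\<^sup>2" by (simp add: add_pos_nonneg)
next
  fix k :: nat assume k: "k \<ge> 1"
  define K where "K = real k + \<alpha> / 2"
  have yk: "y k = u k - (- K) *\<^sub>R g k" unfolding y_def K_def scaleR_minus_left by simp
  have "B (y k) (y k) \<le> 2 * B (u k) (u k) + 2 * (K\<^sup>2 * B (g k) (g k))"
    using square_diff_le[of "u k" "(- K) *\<^sub>R g k"] unfolding yk[symmetric]
    by (simp add: bilinear power2_eq_square)
  moreover have "K\<^sup>2 \<le> (2 + \<alpha>\<^sup>2 / 2) * (real k)\<^sup>2"
  proof -
    have "K\<^sup>2 \<le> 2 * (real k)\<^sup>2 + 2 * (\<alpha> / 2)\<^sup>2"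
      using sum_squares_bound[of "real k" "\<alpha> / 2"] by (simp add: K_def power2_sum)
    moreover have "1\<^sup>2 \<le> (real k)\<^sup>2" using k by (intro power_mono) auto
    then have "(\<alpha>\<^sup>2 / 2) * 1 \<le> (\<alpha>\<^sup>2 / 2) * (real k)\<^sup>2" by (intro mult_left_mono) auto
    ultimately show ?thesis by (simp add: algebra_simps power2_eq_square)
  qed
  then have "K\<^sup>2 * B (g k) (g k) \<le> (2 + \<alpha>\<^sup>2 / 2) * (real k)\<^sup>2 * B (g k) (g k)"
    by (intro mult_right_mono nonneg)
  moreover have "B (u k) (u k) = (real k)\<^sup>2 * B (\<Delta> k) (\<Delta> k)"
    by (simp add: u_def bilinear power2_eq_square)
  ultimately have "4 * P k \<le> 3 * ((real k)\<^sup>2 * B (\<Delta> k) (\<Delta> k)) + (4 + \<alpha>\<^sup>2) * ((real k)\<^sup>2 * B (g k) (g k))"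
    unfolding P_def by (simp add: algebra_simps)
  also have "\<dots> \<le> (4 + 4 * \<alpha>\<^sup>2) * ((real k)\<^sup>2 * B (\<Delta> k) (\<Delta> k)) + (4 + 4 * \<alpha>\<^sup>2) * ((real k)\<^sup>2 * B (g k) (g k))"
    by (intro add_mono mult_right_mono mult_nonneg_nonneg nonneg)
       (use zero_le_power2[of \<alpha>] in \<open>auto simp: add_nonneg_nonneg\<close>)
  finally show "P k \<le> (1 + \<alpha>\<^sup>2) * (real k * (real k * R k))"
    by (simp add: R_def algebra_simps power2_eq_square)
qed

section \<open>Convergence of the energy and the resulting rates\<close>

lemma E_convergent:
  assumes \<mu>: "1 < \<mu>" "\<mu> < \<alpha> - 1"
  shows "convergent (E \<mu>)" "summable (\<lambda>k. real k * R k)" "Bseq (\<lambda>k. B (a k) (a k))"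
proof -
  obtain \<delta> where \<delta>: "\<delta> > 0" "\<forall>\<^sub>F k in sequentially. E \<mu> (Suc k) \<le> E \<mu> k - \<delta> * (real k * R (Suc k))"
    using E_descent[OF \<mu>] by blast
  obtain N where N: "\<And>k. k \<ge> N \<Longrightarrow> E \<mu> (Suc k) \<le> E \<mu> k - \<delta> * (real k * R (Suc k))"
    "\<And>k. k \<ge> N \<Longrightarrow> \<mu> * (\<alpha> - 1 - \<mu>) / 4 * B (a k) (a k) \<le> E \<mu> k" "N \<ge> 1"
    using eventually_conj[OF eventually_conj[OF \<delta>(2) E_lower[OF \<mu>]] eventually_ge_at_top[of 1]]
    unfolding eventually_sequentially by (metis order_refl)
  \<comment> \<open>The shift starts where descent and the lower bound both hold, so
    \<open>e\<close> is nonnegative and decreasing, and its total decrease bounds the sum of the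
    dissipation.\<close>
  define e where "e k = E \<mu> (k + N)" for k
  have pos: "\<mu> * (\<alpha> - 1 - \<mu>) / 4 > 0" using \<mu> by simp
  have e0: "0 \<le> e k" for k
    using N(2)[of "k + N"] mult_nonneg_nonneg[OF less_imp_le[OF pos] nonneg[of "a (k + N)"]]
    unfolding e_def by linarith
  have step: "e (Suc k) \<le> e k - \<delta> * (real (k + N) * R (Suc (k + N)))" for k
    using N(1)[of "k + N"] by (simp add: e_def)
  have dec: "e (Suc k) \<le> e k" for k
    using step[of k] mult_nonneg_nonneg[OF less_imp_le[OF \<delta>(1)] mult_nonneg_nonneg[OF _ R_nonneg[of "Suc (k + N)"], of "real (k + N)"]]
    by linarith
  have "decseq e" using dec by (rule decseq_SucI)
  then have le0: "e k \<le> e 0" for k by (simp add: decseq_def)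
  have "convergent e"
    using decseq_convergent[OF \<open>decseq e\<close>, of 0] e0 unfolding convergent_def by blast
  then show "convergent (E \<mu>)" unfolding e_def by (simp add: convergent_ignore_initial_segment)
  have "summable (\<lambda>k. e k - e (Suc k))"
    using \<open>convergent e\<close> by (auto simp: convergent_def dest!: telescope_summable')
  then have "summable (\<lambda>k. \<delta> * (real (k + N) * R (Suc (k + N))))"
  proof (rule summable_comparison_test'[where N = 0])
    fix k
    show "norm (\<delta> * (real (k + N) * R (Suc (k + N)))) \<le> e k - e (Suc k)"
      using step[of k] \<delta>(1) R_nonneg by simp
  qed
  then have "summable (\<lambda>k. real (k + N) * R (Suc (k + N)))"
    using \<delta>(1) by (simp add: summable_cmult_iff)
  \<comment> \<open>The descent weighs \<open>R (Suc k)\<close> by \<open>k\<close>; since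
    \<open>N \<ge> 1\<close>, doubling that weight covers the index \<open>k + 1\<close>.\<close>
  from summable_mult[OF this, of 2] have "summable (\<lambda>k. real (k + Suc N) * R (k + Suc N))"
  proof (rule summable_comparison_test'[where N = 0])
    fix k
    have "real (k + Suc N) * R (k + Suc N) \<le> (2 * real (k + N)) * R (k + Suc N)"
      using N(3) by (intro mult_right_mono R_nonneg) auto
    then show "norm (real (k + Suc N) * R (k + Suc N)) \<le> 2 * (real (k + N) * R (Suc (k + N)))"
      using R_nonneg by (simp add: abs_mult algebra_simps)
  qed
  then show "summable (\<lambda>k. real k * R k)" by (rule summable_iff_shift[of "\<lambda>k. real k * R k" "Suc N", THEN iffD1])
  have "norm (B (a (k + N)) (a (k + N))) \<le> e 0 / (\<mu> * (\<alpha> - 1 - \<mu>) / 4)" for k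
    using N(2)[of "k + N"] le0[of k] nonneg[of "a (k + N)"] pos
    unfolding e_def by (simp only: pos_le_divide_eq real_norm_def abs_of_nonneg mult.commute) (metis add_leE le_add2 order.trans)
  then have "Bseq (\<lambda>k. B (a (k + N)) (a (k + N)))" by (rule BseqI')
  then show "Bseq (\<lambda>k. B (a k) (a k))" by (rule Bseq_offset)
qed

theorem rates:
  shows "(\<lambda>k. (real k)\<^sup>2 * B (z k - z (k - 1)) (z k - z (k - 1))) \<longlonglongrightarrow> 0"
    and "(\<lambda>k. (real k)\<^sup>2 * B (g k) (g k)) \<longlonglongrightarrow> 0"
    and "convergent (\<lambda>k. B (z k - zs) (z k - zs))"
proof -
  \<comment> \<open>The two points that divide the interval from \<open>1\<close> to
    \<open>\<alpha> - 1\<close> into thirds.\<close>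
  define \<mu>1 \<mu>2 where "\<mu>1 = (\<alpha> + 1) / 3" and "\<mu>2 = (2 * \<alpha> - 1) / 3"
  have \<mu>1: "1 < \<mu>1" "\<mu>1 < \<alpha> - 1" and \<mu>2: "1 < \<mu>2" "\<mu>2 < \<alpha> - 1"
    using \<alpha> by (simp_all add: \<mu>1_def \<mu>2_def field_simps)
  have "\<mu>1 < \<mu>2" using \<alpha> by (simp add: \<mu>1_def \<mu>2_def divide_strict_right_mono)
  then have ne: "\<mu>2 - \<mu>1 \<noteq> 0" by simp
  note conv = E_convergent(1)[OF \<mu>1] E_convergent(1)[OF \<mu>2]
  \<comment> \<open>\<open>Q\<close> is the slope of \<open>E\<close> as a function of its first
    argument.\<close>
  have "convergent (\<lambda>k. (E \<mu>2 k - E \<mu>1 k) * (1 / (\<mu>2 - \<mu>1)))"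
    by (intro convergent_mult convergent_diff conv convergent_const)
  moreover have "(\<lambda>k. (E \<mu>2 k - E \<mu>1 k) * (1 / (\<mu>2 - \<mu>1))) = Q"
    using ne by (auto simp: E_def fun_eq_iff field_simps)
  ultimately have Q: "convergent Q" by simp
  have "convergent (\<lambda>k. E \<mu>1 k - \<mu>1 * Q k)"
    by (intro convergent_diff conv convergent_mult convergent_const Q)
  then have "convergent P" by (simp add: E_def)
  then obtain L where L: "P \<longlonglongrightarrow> L" unfolding convergent_def by blast
  have P0: "0 \<le> P k" for k by (simp add: P_def nonneg)
  then have "0 \<le> L" using L by (intro LIMSEQ_le_const[OF L]) auto
  \<comment> \<open>Otherwise \<open>P k \<le> C k\<^sup>2 R k\<close> and summability of \<open>k R k\<close> would make the harmonic series converge.\<close>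
  have "L = 0"
  proof (rule ccontr)
    assume "L \<noteq> 0"
    with \<open>0 \<le> L\<close> have L0: "L > 0" by simp
    obtain C where C: "C > 0" "\<And>k. k \<ge> 1 \<Longrightarrow> P k \<le> C * (real k * (real k * R k))" using P_le by blast
    have "L / 2 < L" using L0 by simp
    have "\<forall>\<^sub>F k in sequentially. norm (inverse (real k)) \<le> 2 * C / L * (real k * R k)"
      using order_tendstoD(1)[OF L \<open>L / 2 < L\<close>] eventually_ge_at_top[of 1]
    proof eventually_elim
      case (elim k)
      then show ?case using C(2)[of k] C(1) L0 by (simp add: field_simps)
    qed
    moreover have "summable (\<lambda>k. 2 * C / L * (real k * R k))"
      by (intro summable_mult E_convergent(2)[OF \<mu>1])
    ultimately have "summable (\<lambda>k. inverse (real k))" by (rule summable_comparison_test_ev)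
    then show False using not_summable_harmonic by blast
  qed
  with L have P: "P \<longlonglongrightarrow> 0" by simp
  have "(\<lambda>k. 4 * P k) \<longlonglongrightarrow> 4 * 0" by (intro tendsto_intros P)
  then have P4: "(\<lambda>k. 4 * P k) \<longlonglongrightarrow> 0" by simp
  have uu: "(\<lambda>k. B (u k) (u k)) \<longlonglongrightarrow> 0"
    by (rule tendsto_sandwich[OF _ _ tendsto_const P4]) (auto simp: P_def nonneg)
  have yy: "(\<lambda>k. B (y k) (y k)) \<longlonglongrightarrow> 0"
    by (rule tendsto_sandwich[OF _ _ tendsto_const P4]) (auto simp: P_def nonneg)
  show "(\<lambda>k. (real k)\<^sup>2 * B (z k - z (k - 1)) (z k - z (k - 1))) \<longlonglongrightarrow> 0"
    using uu unfolding u_def scale_left scale_right \<Delta>_def by (simp add: power2_eq_square mult.assoc)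
  have "(\<lambda>k. 2 * B (y k) (y k) + 2 * B (u k) (u k)) \<longlonglongrightarrow> 2 * 0 + 2 * 0"
    by (intro tendsto_intros yy uu)
  then have "(\<lambda>k. 2 * B (y k) (y k) + 2 * B (u k) (u k)) \<longlonglongrightarrow> 0" by simp
  then show "(\<lambda>k. (real k)\<^sup>2 * B (g k) (g k)) \<longlonglongrightarrow> 0"
  proof (rule tendsto_sandwich[OF _ _ tendsto_const, rotated 2])
    show "\<forall>\<^sub>F k in sequentially. (real k)\<^sup>2 * B (g k) (g k) \<le> 2 * B (y k) (y k) + 2 * B (u k) (u k)"
    proof (intro always_eventually allI)
      fix k
      have "(real k)\<^sup>2 * B (g k) (g k) \<le> (real k + \<alpha> / 2)\<^sup>2 * B (g k) (g k)"
        using \<alpha> by (intro mult_right_mono nonneg power_mono) auto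
      \<comment> \<open>By definition of \<open>y\<close> the weighted residual is
        \<open>y k - u k\<close>, so it inherits both limits.\<close>
      also have "\<dots> = B (y k - u k) (y k - u k)"
        by (simp add: y_def bilinear power2_eq_square)
      also have "\<dots> \<le> 2 * B (y k) (y k) + 2 * B (u k) (u k)" by (rule square_diff_le)
      finally show "(real k)\<^sup>2 * B (g k) (g k) \<le> 2 * B (y k) (y k) + 2 * B (u k) (u k)" .
    qed
  qed (simp add: nonneg)
  obtain M where "\<And>k. norm (B (a k) (a k)) \<le> M"
    using E_convergent(3)[OF \<mu>1] unfolding Bseq_def by blast
  then have M: "B (a k) (a k) \<le> M" for k
    using abs_ge_self order.trans unfolding real_norm_def by blast
  have "(\<lambda>k. M * B (y k) (y k)) \<longlonglongrightarrow> M * 0" by (intro tendsto_intros yy)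
  then have "(\<lambda>k. M * B (y k) (y k)) \<longlonglongrightarrow> 0" by simp
  then have "(\<lambda>k. (B (a k) (y k))\<^sup>2) \<longlonglongrightarrow> 0"
  proof (rule tendsto_sandwich[OF _ _ tendsto_const, rotated 2])
    show "\<forall>\<^sub>F k in sequentially. (B (a k) (y k))\<^sup>2 \<le> M * B (y k) (y k)"
      by (intro always_eventually allI order.trans[OF cauchy_schwarz mult_right_mono[OF M nonneg]])
  qed simp
  then have "(\<lambda>k. B (a k) (y k)) \<longlonglongrightarrow> 0"
    by (simp only: power_tendsto_0_iff[OF zero_less_numeral])
  \<comment> \<open>As \<open>a\<close> is bounded and \<open>y\<close> vanishes in the limit,
    \<open>Q\<close> reduces to the squared distance up to the factor
    \<open>(\<alpha> - 1) / 2\<close>.\<close>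
  then have "convergent (\<lambda>k. (Q k - B (a k) (y k)) * (2 / (\<alpha> - 1)))"
    by (intro convergent_diff convergent_mult convergent_const Q) (auto simp: convergent_def)
  then show "convergent (\<lambda>k. B (z k - zs) (z k - zs))"
    using \<alpha> by (simp add: Q_def a_def)
qed

end

text \<open>Proximal points \<open>p n\<close> of \<open>q\<close> with step sizes tending to
  \<open>0\<close> carry subgradients \<open>(q - p n) / \<gamma> n\<close>. The affine bound there
  yields \<open>f (p n) \<le> M\<close>, the minorant from \<open>s\<close> forces
  \<open>p n\<close> to approach \<open>q\<close>, and lower semicontinuity concludes. This replaces
  weak lower semicontinuity at cluster points.\<close>

lemma lower_semicontinuous_le_if_affine_minorants_le:
  fixes f :: "'a::{real_inner, complete_space} \<Rightarrow> ereal"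
  assumes f: "proper_fun f" "convex_ereal f" "lower_semicontinuous f"
    and s: "s \<in> subdifferential f c"
    and le: "\<And>p u. u \<in> subdifferential f p \<Longrightarrow> f p + ereal (u \<bullet> (q - p)) \<le> ereal M"
  shows "f q \<le> ereal M"
proof -
  define \<gamma> where "\<gamma> n = inverse (real (Suc n))" for n
  define p where "p n = prox (\<gamma> n) f q" for n
  define M' where "M' = M - real_of_ereal (f c) - s \<bullet> (q - c)"
  have \<gamma>: "\<gamma> n > 0" for n by (simp add: \<gamma>_def)
  have \<gamma>0: "\<gamma> \<longlonglongrightarrow> 0" unfolding \<gamma>_def by (rule LIMSEQ_inverse_real_of_nat)
  obtain fc where fc: "f c = ereal fc" using subdifferentialD(1)[OF s] by (cases "f c") auto
  have fp: "f (p n) \<le> ereal M" and dist: "(norm (p n - q))\<^sup>2 \<le> 2 * \<gamma> n * M' + (\<gamma> n)\<^sup>2 * (norm s)\<^sup>2" for n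
  proof -
    have u: "(1 / \<gamma> n) *\<^sub>R (q - p n) \<in> subdifferential f (p n)"
      unfolding p_def by (rule prox_subgradient[OF f s \<gamma>])
    obtain fpn where fpn: "f (p n) = ereal fpn" using subdifferentialD(1)[OF u] by (cases "f (p n)") auto
    define d where "d = (norm (p n - q))\<^sup>2"
    have 1: "fpn + d / \<gamma> n \<le> M"
      using le[OF u] by (simp add: fpn d_def power2_norm_eq_inner norm_minus_commute[of "p n"])
    moreover have "0 \<le> d / \<gamma> n" using \<gamma>[of n] by (simp add: d_def)
    ultimately show "f (p n) \<le> ereal M" by (simp add: fpn)
    have "fc + s \<bullet> (p n - c) \<le> fpn" using subdifferentialD(2)[OF s, of "p n"] by (simp add: fc fpn)
    with 1 have "d / \<gamma> n \<le> M' - s \<bullet> (p n - q)" by (simp add: M'_def fc inner_diff_right)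
    then have "d \<le> \<gamma> n * M' - \<gamma> n * (s \<bullet> (p n - q))" using \<gamma>[of n] by (simp add: field_simps)
    \<comment> \<open>This square removes the linear term in \<open>s\<close> at the cost of half of
      \<open>d\<close>.\<close>
    moreover have "0 \<le> (norm ((p n - q) + \<gamma> n *\<^sub>R s))\<^sup>2" by simp
    then have "0 \<le> d + 2 * (\<gamma> n * (s \<bullet> (p n - q))) + (\<gamma> n)\<^sup>2 * (norm s)\<^sup>2"
      unfolding d_def power2_norm_eq_inner
      by (simp only: inner_add_left inner_add_right inner_scaleR_left inner_scaleR_right inner_commute[of "p n - q" s])
        (simp add: power2_eq_square distrib_left)
    ultimately show "(norm (p n - q))\<^sup>2 \<le> 2 * \<gamma> n * M' + (\<gamma> n)\<^sup>2 * (norm s)\<^sup>2"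
      unfolding d_def[symmetric] by simp
  qed
  have "(\<lambda>n. 2 * \<gamma> n * M' + (\<gamma> n)\<^sup>2 * (norm s)\<^sup>2) \<longlonglongrightarrow> 2 * 0 * M' + 0\<^sup>2 * (norm s)\<^sup>2"
    by (intro tendsto_intros \<gamma>0)
  then have "(\<lambda>n. 2 * \<gamma> n * M' + (\<gamma> n)\<^sup>2 * (norm s)\<^sup>2) \<longlonglongrightarrow> 0" by simp
  then have "(\<lambda>n. (norm (p n - q))\<^sup>2) \<longlonglongrightarrow> 0"
    by (rule Lim_null_comparison[rotated]) (use dist in simp)
  then have "(\<lambda>n. norm (p n - q)) \<longlonglongrightarrow> 0"
    by (simp only: power_tendsto_0_iff[OF zero_less_numeral])
  then have "p \<longlonglongrightarrow> q" by (simp add: tendsto_norm_zero_iff LIM_zero_iff)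
  then show ?thesis
    by (rule lower_semicontinuous_seq[OF f(3) _ tendsto_const]) (use fp in auto)
qed

section \<open>Auxiliary estimates for norms, rates and the extrapolation rule\<close>

lemma norm_adjoint_le:
  fixes A :: "'x::{real_inner, complete_space} \<Rightarrow> 'y::real_inner"
  assumes "bounded_linear A"
  shows "norm (adjoint A y) \<le> onorm A * norm y"
proof (cases "norm (adjoint A y) = 0")
  case True
  then show ?thesis using onorm_pos_le[OF assms] by simp
next
  case False
  have "norm (adjoint A y) * norm (adjoint A y) = A (adjoint A y) \<bullet> y"
    by (simp add: adjoint_hilbert[OF assms] norm_eq_sqrt_inner)
  also have "\<dots> \<le> norm (A (adjoint A y)) * norm y" by (rule norm_cauchy_schwarz)
  also have "\<dots> \<le> (onorm A * norm (adjoint A y)) * norm y"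
    by (intro mult_right_mono onorm[OF assms]) simp
  finally have "norm (adjoint A y) * norm (adjoint A y) \<le> norm (adjoint A y) * (onorm A * norm y)"
    by (simp add: mult_ac)
  with False show ?thesis by (simp add: mult_le_cancel_left)
qed

lemma norm_fst_le': "norm (fst p) \<le> norm p" and norm_snd_le': "norm (snd p) \<le> norm p"
  using norm_fst_le[of "fst p" "snd p"] norm_snd_le[of "snd p" "fst p"] by simp_all

lemma smallo_inverse_if_tendsto:
  fixes s :: "nat \<Rightarrow> real"
  assumes "(\<lambda>k. real k * s k) \<longlonglongrightarrow> 0"
  shows "s \<in> o(\<lambda>k. 1 / real k)"
proof (rule smalloI_tendsto)
  show "((\<lambda>k. s k / (1 / real k)) \<longlongrightarrow> 0) sequentially"
    using assms by (simp add: mult.commute)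
  show "\<forall>\<^sub>F k in sequentially. 1 / real k \<noteq> 0"
    using eventually_gt_at_top[of 0] by eventually_elim simp
qed

text \<open>Rewrites the extrapolation rule in the form demanded by \<open>momentum\<close>; it
  serves the primal and the dual component alike.\<close>

lemma momentum_component:
  fixes x v d g :: "'a::real_vector"
  assumes "k + \<alpha> > 0"
    and "v = x + (1 - \<alpha> / (k + \<alpha>)) *\<^sub>R d + (1 - \<alpha> / (2 * (k + \<alpha>))) *\<^sub>R g"
  shows "(k + \<alpha>) *\<^sub>R (x' - x) = k *\<^sub>R d - (k + \<alpha>) *\<^sub>R ((v - x') - g) - (\<alpha> / 2) *\<^sub>R g"
proof -
  have "(k + \<alpha>) *\<^sub>R (v - x) = ((k + \<alpha>) * (1 - \<alpha> / (k + \<alpha>))) *\<^sub>R d + ((k + \<alpha>) * (1 - \<alpha> / (2 * (k + \<alpha>)))) *\<^sub>R g"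
    unfolding assms(2) by (simp add: scaleR_add_right)
  also have "(k + \<alpha>) * (1 - \<alpha> / (k + \<alpha>)) = k" using assms(1) by (simp add: field_simps)
  also have "(k + \<alpha>) * (1 - \<alpha> / (2 * (k + \<alpha>))) = (k + \<alpha>) - \<alpha> / 2" using assms(1) by (simp add: field_simps)
  finally have "(k + \<alpha>) *\<^sub>R (v - x) = k *\<^sub>R d + ((k + \<alpha>) *\<^sub>R g - (\<alpha> / 2) *\<^sub>R g)"
    by (simp only: scaleR_diff_left)
  moreover have "(k + \<alpha>) *\<^sub>R (x' - x) = (k + \<alpha>) *\<^sub>R (v - x) - (k + \<alpha>) *\<^sub>R ((v - x') - g) - (k + \<alpha>) *\<^sub>R g"
    by (simp only: scaleR_diff_right) simp
  ultimately show ?thesis by simp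
qed

subsection \<open>The primal-dual iteration\<close>

locale primal_dual_problem =
  fixes f :: "'x::{real_inner, complete_space} \<Rightarrow> ereal"
    and h :: "'x \<Rightarrow> real"
    and A :: "'x \<Rightarrow> 'y::{real_inner, complete_space}"
    and b :: 'y and \<beta> :: real
  assumes f: "proper_fun f" "convex_ereal f" "lower_semicontinuous f"
    and h: "convex_on UNIV h" "h differentiable_on UNIV"
    and \<beta>: "\<beta> > 0"
    and grad_h: "(1 / \<beta>)-lipschitz_on UNIV (gradient h)"
    and A: "bounded_linear A"
begin

abbreviation L where "L \<equiv> lagrangian f h A b"

lemma f_not_minf: "f y \<noteq> - \<infinity>"
  using f(1) unfolding proper_fun_def by blast

text \<open>Testing with the multiplier \<open>ls + (A xs - b)\<close> forces feasibility;
  minimality in the primal variable gives the stationarity condition.\<close>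

lemma saddle_pointD:
  assumes "(xs, ls) \<in> saddle_points L"
  shows "A xs = b" and "- (gradient h xs + adjoint A ls) \<in> subdifferential f xs"
proof -
  have up: "L xs l \<le> L xs ls" and low: "L xs ls \<le> L x ls" for x l
    using assms by (auto simp: saddle_points_def)
  obtain c where c: "f c \<noteq> \<infinity>" using f(1) unfolding proper_fun_def by blast
  have "f xs \<noteq> \<infinity>" using low[of c] c f_not_minf[of c] by (cases "f c") (auto simp: lagrangian_def)
  then obtain r where r: "f xs = ereal r" using f_not_minf[of xs] by (cases "f xs") auto
  have "(ls + (A xs - b)) \<bullet> (A xs - b) \<le> ls \<bullet> (A xs - b)"
    using up[of "ls + (A xs - b)"] by (simp add: lagrangian_def r)
  then have "(A xs - b) \<bullet> (A xs - b) \<le> 0" by (simp add: inner_add_left)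
  then have "(A xs - b) \<bullet> (A xs - b) = 0" using inner_ge_zero[of "A xs - b"] by linarith
  then show "A xs = b" by simp
  show "- (gradient h xs + adjoint A ls) \<in> subdifferential f xs"
  proof (rule minimizer_imp_subgradient[OF f(1,2), where \<psi> = "\<lambda>x. h x + ls \<bullet> (A x - b)"
        and C = "\<lambda>d. 1 / \<beta> / 2 * (norm d)\<^sup>2"])
    fix y
    show "f xs + ereal (h xs + ls \<bullet> (A xs - b)) \<le> f y + ereal (h y + ls \<bullet> (A y - b))"
      using low[of y] unfolding lagrangian_def by (simp add: add.assoc)
  next
    fix d t
    interpret bounded_linear A by (rule A)
    have "h (xs + t *\<^sub>R d) \<le> h xs + gradient h xs \<bullet> (t *\<^sub>R d) + 1 / \<beta> / 2 * (norm (t *\<^sub>R d))\<^sup>2"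
      by (rule lipschitz_gradient_descent[OF h(2) grad_h])
    moreover have "ls \<bullet> A d = adjoint A ls \<bullet> d"
      by (simp add: adjoint_hilbert[OF A] inner_commute[of ls] inner_commute[of d])
    ultimately show "h (xs + t *\<^sub>R d) + ls \<bullet> (A (xs + t *\<^sub>R d) - b)
      \<le> h xs + ls \<bullet> (A xs - b) + t * ((gradient h xs + adjoint A ls) \<bullet> d) + t\<^sup>2 * (1 / \<beta> / 2 * (norm d)\<^sup>2)"
      by (simp add: add scaleR inner_add_left inner_add_right inner_diff_right power_mult_distrib algebra_simps)
  qed
qed

text \<open>At a feasible \<open>q\<close> the Lagrangian does not depend on the multiplier, so only
  minimality at points of finite value remains.\<close>

lemma saddle_pointI:
  assumes "A q = b" "f q = ereal r"
    and "\<And>x' r'. f x' = ereal r' \<Longrightarrow> r + h q \<le> r' + h x' + lq \<bullet> (A x' - b)"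
  shows "(q, lq) \<in> saddle_points L"
proof -
  have "L q l = ereal (r + h q)" for l
    by (simp add: lagrangian_def assms)
  moreover have "ereal (r + h q) \<le> L x' lq" for x'
    using assms(3)[of x'] f_not_minf[of x'] by (cases "f x'") (auto simp: lagrangian_def)
  ultimately show ?thesis by (simp add: saddle_points_def)
qed

end


text \<open>The steps for \<open>x\<close> and \<open>l\<close> are assumed from
  \<open>k = 0\<close> on, which merges the initialisation with the general iteration.\<close>

locale primal_dual_iteration = primal_dual_problem f h A b \<beta>
  for f :: "'x::{real_inner, complete_space} \<Rightarrow> ereal"
    and h :: "'x \<Rightarrow> real"
    and A :: "'x \<Rightarrow> 'y::{real_inner, complete_space}"
    and b :: 'y and \<beta> :: real +
  fixes \<alpha> \<tau> \<sigma> :: real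
    and xs :: 'x and ls :: 'y
    and x v :: "nat \<Rightarrow> 'x" and l \<eta> :: "nat \<Rightarrow> 'y"
  assumes saddle: "(xs, ls) \<in> saddle_points (lagrangian f h A b)"
    and \<alpha>: "\<alpha> > 2" and \<tau>: "\<tau> > 0" and \<sigma>: "\<sigma> > 0"
    and step: "1 < min (1 / \<tau>) (1 / \<sigma>) * (1 - sqrt (\<tau> * \<sigma> * (onorm A)\<^sup>2))
                     * (8 * (\<alpha> - 1) / (5 * \<alpha> - 2)) * \<beta>"
    and v_step: "k \<ge> 1 \<Longrightarrow>
       v k = x k + (1 - \<alpha> / (real k + \<alpha>)) *\<^sub>R (x k - x (k - 1))
                 + (1 - \<alpha> / (2 * (real k + \<alpha>))) *\<^sub>R (v (k - 1) - x k)"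
    and \<eta>_step: "k \<ge> 1 \<Longrightarrow>
       \<eta> k = l k + (1 - \<alpha> / (real k + \<alpha>)) *\<^sub>R (l k - l (k - 1))
                 + (1 - \<alpha> / (2 * (real k + \<alpha>))) *\<^sub>R (\<eta> (k - 1) - l k)"
    and x_step: "x (Suc k) = prox \<tau> f (v k - \<tau> *\<^sub>R adjoint A (\<eta> k) - \<tau> *\<^sub>R gradient h (x k))"
    and l_step: "l (Suc k) = \<eta> k + \<sigma> *\<^sub>R (A (x (Suc k)) - b) + \<sigma> *\<^sub>R A (x (Suc k) - v k)"
begin

sublocale A: bounded_linear A by (rule A)

text \<open>The coercivity constant of the metric, called \<open>m\<close> in the overview;
  unrelated to the energy parameter of \<open>E\<close>.\<close>

definition \<mu> where "\<mu> = min (1 / \<tau>) (1 / \<sigma>) * (1 - sqrt (\<tau> * \<sigma> * (onorm A)\<^sup>2))"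
definition B where "B p q = fst p \<bullet> fst q / \<tau> + snd p \<bullet> snd q / \<sigma> - A (fst p) \<bullet> snd q - A (fst q) \<bullet> snd p"
definition z where "z k = (x k, l k)"
text \<open>At \<open>k = 0\<close> truncated subtraction makes this a dummy value; the optimality
  facts are stated from \<open>k = 1\<close> on.\<close>

definition g where "g k = (v (k - 1) - x k, \<eta> (k - 1) - l k)"
text \<open>The subgradient of \<open>f\<close> at \<open>x k\<close> produced by the proximal
  step.\<close>

definition t where "t k = (1 / \<tau>) *\<^sub>R (v (k - 1) - x k) - adjoint A (\<eta> (k - 1)) - gradient h (x (k - 1))"
definition D where "D k p = fst p \<bullet> (gradient h (x k) - gradient h (x (k - 1)))"
text \<open>By coercivity, division by \<open>\<mu>\<close> bounds the squared dual norm of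
  \<open>D k\<close> in the metric \<open>B\<close>.\<close>

definition n where "n k = (norm (gradient h (x k) - gradient h (x (k - 1))))\<^sup>2 / \<mu>"

text \<open>The factor \<open>8 * (\<alpha> - 1) / (5 * \<alpha> - 2)\<close> lies strictly between
  \<open>0\<close> and \<open>2\<close>, so the step condition yields both claims.\<close>

lemma \<mu>_pos: "\<mu> > 0" and \<mu>\<beta>: "\<mu> * \<beta> > 1 / 2"
proof -
  define r where "r = 8 * (\<alpha> - 1) / (5 * \<alpha> - 2)"
  have r: "0 < r" "r < 2" using \<alpha> by (auto simp: r_def field_simps)
  have 1: "1 < \<mu> * r * \<beta>" using step by (simp add: \<mu>_def r_def)
  have "0 < r * \<beta>" using r \<beta> by simp
  moreover have "0 < \<mu> * (r * \<beta>)" using 1 by (simp add: mult.assoc)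
  ultimately show "\<mu> > 0" by (rule zero_less_mult_pos2[rotated])
  then have "\<mu> * \<beta> * r < \<mu> * \<beta> * 2" using r \<beta> by (intro mult_strict_left_mono) auto
  with 1 show "\<mu> * \<beta> > 1 / 2" by (simp add: mult_ac)
qed

text \<open>After scaling the components by \<open>sqrt \<tau>\<close> and
  \<open>sqrt \<sigma>\<close>, the coupling term is at most \<open>s\<close> times the diagonal
  part \<open>N\<close>, and \<open>s < 1\<close>.\<close>

lemma B_coercive: "\<mu> * (norm p)\<^sup>2 \<le> B p p"
proof -
  obtain a c where p: "p = (a, c)" by (cases p)
  define s where "s = sqrt (\<tau> * \<sigma> * (onorm A)\<^sup>2)"
  define m where "m = min (1 / \<tau>) (1 / \<sigma>)"
  define N where "N = (norm a)\<^sup>2 / \<tau> + (norm c)\<^sup>2 / \<sigma>"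
  have m: "m > 0" "m \<le> 1 / \<tau>" "m \<le> 1 / \<sigma>" using \<tau> \<sigma> by (auto simp: m_def)
  have "0 < 1 - s"
    using zero_less_mult_pos[OF _ m(1), of "1 - s"] \<mu>_pos by (simp only: \<mu>_def s_def m_def)
  have s: "s = sqrt \<tau> * sqrt \<sigma> * onorm A"
    using onorm_pos_le[OF A] by (simp add: s_def real_sqrt_mult)
  have "2 * (A a \<bullet> c) \<le> 2 * (onorm A * norm a * norm c)"
    using norm_cauchy_schwarz[of "A a" c] mult_right_mono[OF onorm[OF A, of a] norm_ge_zero[of c]] by linarith
  also have "\<dots> = s * (2 * (norm a / sqrt \<tau>) * (norm c / sqrt \<sigma>))"
    using \<tau> \<sigma> by (simp add: s)
  also have "\<dots> \<le> s * ((norm a / sqrt \<tau>)\<^sup>2 + (norm c / sqrt \<sigma>)\<^sup>2)"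
    using sum_squares_bound[of "norm a / sqrt \<tau>" "norm c / sqrt \<sigma>"]
    using \<tau> \<sigma> by (intro mult_left_mono) (auto simp: s_def)
  also have "\<dots> = s * N" using \<tau> \<sigma> by (simp add: N_def power_divide)
  finally have "2 * (A a \<bullet> c) \<le> s * N" .
  moreover have "B p p = N - 2 * (A a \<bullet> c)" by (simp add: B_def p N_def power2_norm_eq_inner)
  ultimately have "(1 - s) * N \<le> B p p" by (simp add: left_diff_distrib)
  moreover have "m * (norm p)\<^sup>2 \<le> N"
  proof -
    have "m * (norm p)\<^sup>2 = m * (norm a)\<^sup>2 + m * (norm c)\<^sup>2"
      by (simp add: p norm_prod_def distrib_left)
    also have "\<dots> \<le> 1 / \<tau> * (norm a)\<^sup>2 + 1 / \<sigma> * (norm c)\<^sup>2"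
      by (intro add_mono mult_right_mono m) auto
    finally show ?thesis by (simp add: N_def)
  qed
  then have "(1 - s) * (m * (norm p)\<^sup>2) \<le> (1 - s) * N"
    using \<open>0 < 1 - s\<close> by (intro mult_left_mono) auto
  moreover have "\<mu> * (norm p)\<^sup>2 = (1 - s) * (m * (norm p)\<^sup>2)"
    by (simp add: \<mu>_def s_def m_def)
  ultimately show ?thesis by linarith
qed

sublocale B: semi_inner B
proof
  show "0 \<le> B p p" for p
    using B_coercive[of p] mult_nonneg_nonneg[OF less_imp_le[OF \<mu>_pos] zero_le_power2[of "norm p"]] by linarith
qed (auto simp: B_def inner_add_left inner_commute A.add A.scaleR add_divide_distrib inner_add_right algebra_simps)

lemma t_subgradient: "k \<ge> 1 \<Longrightarrow> t k \<in> subdifferential f (x k)"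
proof -
  assume "k \<ge> 1"
  then obtain j where j: "k = Suc j" by (cases k) auto
  have "(1 / \<tau>) *\<^sub>R ((v j - \<tau> *\<^sub>R adjoint A (\<eta> j) - \<tau> *\<^sub>R gradient h (x j)) - x (Suc j)) \<in> subdifferential f (x (Suc j))"
    unfolding x_step by (rule prox_subgradient[OF f saddle_pointD(2)[OF saddle] \<tau>])
  also have "(1 / \<tau>) *\<^sub>R ((v j - \<tau> *\<^sub>R adjoint A (\<eta> j) - \<tau> *\<^sub>R gradient h (x j)) - x (Suc j)) = t k"
    using \<tau> by (simp add: t_def j scaleR_diff_right)
  finally show ?thesis by (simp add: j)
qed

lemma dual_residual: "k \<ge> 1 \<Longrightarrow> (1 / \<sigma>) *\<^sub>R snd (g k) - A (fst (g k)) = b - A (x k)"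
proof -
  assume "k \<ge> 1"
  then obtain j where j: "k = Suc j" by (cases k) auto
  have "snd (g k) = \<sigma> *\<^sub>R (b - A (x k) + A (v j - x k))"
    by (simp add: g_def j l_step[of j] A.diff algebra_simps)
  then show ?thesis using \<sigma> by (simp add: g_def j)
qed

lemma primal_residual: "(1 / \<tau>) *\<^sub>R fst (g k) - adjoint A (snd (g k)) = t k + gradient h (x (k - 1)) + adjoint A (l k)"
  by (simp add: g_def t_def adjoint_hilbert_diff[OF A])

text \<open>The forward-backward inclusion in weak form: the metric applied to \<open>g k\<close> is
  the monotone part at index \<open>k\<close> plus the gradient at index
  \<open>k - 1\<close>.\<close>

lemma B_g:
  assumes "k \<ge> 1"
  shows "B p (g k) = fst p \<bullet> (t k + gradient h (x (k - 1)) + adjoint A (l k)) - snd p \<bullet> (A (x k) - b)"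
proof -
  have "B p (g k) = fst p \<bullet> ((1 / \<tau>) *\<^sub>R fst (g k) - adjoint A (snd (g k)))
      + snd p \<bullet> ((1 / \<sigma>) *\<^sub>R snd (g k) - A (fst (g k)))"
    by (simp add: B_def inner_diff_right adjoint_hilbert[OF A] inner_commute[of "snd p"])
  then show ?thesis unfolding primal_residual dual_residual[OF assms] by (simp add: inner_diff_right)
qed

text \<open>The reference point is an arbitrary saddle point because Opial's argument compares
  distances to two of them.\<close>

lemma momentum_at_saddle_point:
  assumes "(xq, lq) \<in> saddle_points (lagrangian f h A b)"
  shows "momentum B z g D n \<alpha> (\<mu> * \<beta>) (xq, lq)"
proof (intro momentum.intro momentum_axioms.intro B.semi_inner_axioms)
  note q = saddle_pointD[OF assms]
  show "\<alpha> > 2" "\<mu> * \<beta> > 1 / 2" by (rule \<alpha> \<mu>\<beta>)+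
  show "linear (D k)" for k
    by (rule linearI) (simp_all add: D_def inner_add_left)
  show "0 \<le> n k" for k using \<mu>_pos by (simp add: n_def)
  show "D k p \<le> (c * B p p + n k / c) / 2" if c: "c > 0" for k c p
  proof -
    define d where "d = gradient h (x k) - gradient h (x (k - 1))"
    have "D k p \<le> norm (fst p) * norm d" unfolding D_def d_def by (rule norm_cauchy_schwarz)
    also have "\<dots> \<le> norm p * norm d" by (intro mult_right_mono norm_fst_le') auto
    also have "2 * (norm p * norm d) \<le> c * \<mu> * (norm p)\<^sup>2 + (norm d)\<^sup>2 / (c * \<mu>)"
    proof -
      have cm: "c * \<mu> > 0" using c \<mu>_pos by simp
      have "0 \<le> (c * \<mu> * norm p - norm d)\<^sup>2" by simp
      then have "(c * \<mu>) * (2 * (norm p * norm d)) \<le> (c * \<mu>) * (c * \<mu> * (norm p)\<^sup>2) + (norm d)\<^sup>2"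
        by (simp add: power2_diff power2_eq_square algebra_simps)
      also have "\<dots> = (c * \<mu>) * (c * \<mu> * (norm p)\<^sup>2 + (norm d)\<^sup>2 / (c * \<mu>))"
        using c \<mu>_pos by (simp add: distrib_left)
      finally show ?thesis using cm by (simp only: mult_le_cancel_left_pos)
    qed
    also have "c * \<mu> * (norm p)\<^sup>2 \<le> c * B p p"
      using B_coercive[of p] c by (simp add: mult.assoc)
    finally show ?thesis by (simp add: n_def d_def mult.commute)
  qed
  fix k :: nat assume k: "1 \<le> k"
  show "(real k + \<alpha>) *\<^sub>R (z (Suc k) - z k)
        = real k *\<^sub>R (z k - z (k - 1)) - (real k + \<alpha>) *\<^sub>R (g (Suc k) - g k) - (\<alpha> / 2) *\<^sub>R g k"
    using momentum_component[OF _ v_step[OF k], of "x (Suc k)"] momentum_component[OF _ \<eta>_step[OF k], of "l (Suc k)"] \<alpha>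
    by (simp add: z_def g_def prod_eq_iff)
  have coco: "\<beta> * (norm (gradient h p - gradient h q))\<^sup>2 \<le> (p - q) \<bullet> (gradient h p - gradient h q)" for p q
    using gradient_cocoercive[OF h \<beta> grad_h, of p q] by (simp add: inner_commute)
  show "\<mu> * \<beta> * n k \<le> D k (z k - z (k - 1))"
    using coco[of "x k" "x (k - 1)"] \<mu>_pos by (simp add: n_def D_def z_def)
  \<comment> \<open>The coupling terms through \<open>A\<close> are skew and cancel; monotonicity of
    the subdifferential leaves only the gradient difference.\<close>
  show "D k (z (Suc k) - z k) \<le> B (z (Suc k) - z k) (g (Suc k) - g k)"
    using subdifferential_monotone[OF t_subgradient[of "Suc k"] t_subgradient[OF k]]
    unfolding B.diff_right B_g[OF k] B_g[of "Suc k", simplified]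
    by (simp add: D_def z_def inner_diff_right inner_diff_left inner_add_right
        adjoint_hilbert[OF A, symmetric] A.diff inner_commute[of "l _"] inner_commute[of "t _"])
  \<comment> \<open>The gradient is taken at \<open>x (k - 1)\<close>, so cocoercivity applies only
    to \<open>x (k - 1) - xq\<close>; the remaining step \<open>e\<close> costs a completed
    square.\<close>
  show "- (B (z k - z (k - 1)) (z k - z (k - 1)) / (4 * (\<mu> * \<beta>))) \<le> B (z k - (xq, lq)) (g k)"
  proof -
    define d where "d = gradient h (x (k - 1)) - gradient h xq"
    define e where "e = x k - x (k - 1)"
    have "B (z k - (xq, lq)) (g k) = (t k + gradient h xq + adjoint A lq) \<bullet> (x k - xq) + (x k - xq) \<bullet> d"
      unfolding B_g[OF k] d_def
      by (simp add: z_def inner_diff_right inner_diff_left inner_add_right inner_add_left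
        adjoint_hilbert[OF A, symmetric] A.diff q(1) inner_commute[of "l _"] inner_commute[of lq]
        inner_commute[of "t _"] inner_commute[of "adjoint A _"] inner_commute[of "gradient h _"])
    moreover have "0 \<le> (t k + gradient h xq + adjoint A lq) \<bullet> (x k - xq)"
      using subdifferential_monotone[OF t_subgradient[OF k] q(2)] by (simp only: diff_minus_eq_add add.assoc)
    moreover have "(x k - xq) \<bullet> d = e \<bullet> d + (x (k - 1) - xq) \<bullet> d"
      by (simp add: e_def inner_diff_left)
    moreover have "\<beta> * (norm d)\<^sup>2 \<le> (x (k - 1) - xq) \<bullet> d" unfolding d_def by (rule coco)
    moreover have "0 \<le> (norm e)\<^sup>2 / (4 * \<beta>) + e \<bullet> d + \<beta> * (norm d)\<^sup>2"
    proof -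
      have "0 \<le> (norm (e + (2 * \<beta>) *\<^sub>R d))\<^sup>2 / (4 * \<beta>)" using \<beta> by simp
      also have "\<dots> = (norm e)\<^sup>2 / (4 * \<beta>) + e \<bullet> d + \<beta> * (norm d)\<^sup>2"
        using \<beta> unfolding power2_norm_eq_inner
        by (simp add: inner_add_left inner_add_right inner_commute[of d e] field_simps)
      finally show ?thesis .
    qed
    moreover have "(norm e)\<^sup>2 / (4 * \<beta>) \<le> B (z k - z (k - 1)) (z k - z (k - 1)) / (4 * (\<mu> * \<beta>))"
    proof -
      have "\<mu> * (norm e)\<^sup>2 \<le> \<mu> * (norm (z k - z (k - 1)))\<^sup>2"
        using \<mu>_pos norm_fst_le'[of "z k - z (k - 1)"] by (intro mult_left_mono power_mono) (auto simp: e_def z_def)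
      also have "\<dots> \<le> B (z k - z (k - 1)) (z k - z (k - 1))" by (rule B_coercive)
      finally show ?thesis using \<mu>_pos \<beta> by (simp add: field_simps)
    qed
    ultimately show ?thesis by linarith
  qed
qed


section \<open>Rates in norm and boundedness of the iterates\<close>

lemma z_step_rate: "(\<lambda>k. real k * norm (z k - z (k - 1))) \<longlonglongrightarrow> 0"
  and g_rate: "(\<lambda>k. real k * norm (g k)) \<longlonglongrightarrow> 0"
proof -
  interpret momentum B z g D n \<alpha> "\<mu> * \<beta>" "(xs, ls)"
    by (rule momentum_at_saddle_point[OF saddle])
  have *: "(\<lambda>k. real k * norm (p k)) \<longlonglongrightarrow> 0"
    if lim: "(\<lambda>k. (real k)\<^sup>2 * B (p k) (p k)) \<longlonglongrightarrow> 0" for p :: "nat \<Rightarrow> 'x \<times> 'y"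
  proof -
    have "(\<lambda>k. 1 / \<mu> * ((real k)\<^sup>2 * B (p k) (p k))) \<longlonglongrightarrow> 1 / \<mu> * 0"
      by (intro tendsto_intros lim)
    then have "(\<lambda>k. 1 / \<mu> * ((real k)\<^sup>2 * B (p k) (p k))) \<longlonglongrightarrow> 0" by simp
    then have "(\<lambda>k. (real k * norm (p k))\<^sup>2) \<longlonglongrightarrow> 0"
    proof (rule Lim_null_comparison[rotated], intro always_eventually allI)
      fix k
      have "(norm (p k))\<^sup>2 \<le> 1 / \<mu> * B (p k) (p k)"
        using B_coercive[of "p k"] \<mu>_pos by (simp add: field_simps)
      from mult_left_mono[OF this, of "(real k)\<^sup>2"]
      show "norm ((real k * norm (p k))\<^sup>2) \<le> 1 / \<mu> * ((real k)\<^sup>2 * B (p k) (p k))"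
        by (simp add: power_mult_distrib mult_ac)
    qed
    then show ?thesis by (simp only: power_tendsto_0_iff[OF zero_less_numeral])
  qed
  show "(\<lambda>k. real k * norm (z k - z (k - 1))) \<longlonglongrightarrow> 0" "(\<lambda>k. real k * norm (g k)) \<longlonglongrightarrow> 0"
    by (rule *, rule rates)+
qed

lemma B_dist_convergent:
  assumes "q \<in> saddle_points L"
  shows "convergent (\<lambda>k. B (z k - q) (z k - q))"
proof -
  obtain xq lq where q: "q = (xq, lq)" by (cases q)
  interpret momentum B z g D n \<alpha> "\<mu> * \<beta>" "(xq, lq)"
    by (rule momentum_at_saddle_point[OF assms[unfolded q]])
  show ?thesis unfolding q by (rule rates(3))
qed

lemma z_bounded: "\<exists>R. \<forall>k. norm (z k) \<le> R"
proof -
  define q where "q = (xs, ls)"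
  obtain K where K: "\<And>k. norm (B (z k - q) (z k - q)) \<le> K"
    using convergent_imp_Bseq[OF B_dist_convergent[OF saddle]] unfolding q_def Bseq_def by blast
  have "norm (z k) \<le> norm q + sqrt (K / \<mu>)" for k
  proof -
    have "\<mu> * (norm (z k - q))\<^sup>2 \<le> K" using B_coercive[of "z k - q"] K[of k] by simp
    then have "(norm (z k - q))\<^sup>2 \<le> K / \<mu>" using \<mu>_pos by (simp add: field_simps)
    then have "norm (z k - q) \<le> sqrt (K / \<mu>)" by (rule real_le_rsqrt)
    then show ?thesis using norm_triangle_sub[of "z k" q] by linarith
  qed
  then show ?thesis by blast
qed

text \<open>For \<open>k \<ge> 1\<close> a subgradient at \<open>x k\<close> of the Lagrangian with
  multiplier \<open>l k\<close>; unlike in \<open>primal_residual\<close>, the gradient is taken at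
  the current point.\<close>

definition r where "r k = t k + adjoint A (l k) + gradient h (x k)"

lemma r_rate: "(\<lambda>k. real k * norm (r k)) \<longlonglongrightarrow> 0"
proof -
  have "(\<lambda>k. (1 / \<tau> + onorm A) * (real k * norm (g k)) + 1 / \<beta> * (real k * norm (z k - z (k - 1))))
      \<longlonglongrightarrow> (1 / \<tau> + onorm A) * 0 + 1 / \<beta> * 0"
    by (intro tendsto_intros g_rate z_step_rate)
  then have "(\<lambda>k. (1 / \<tau> + onorm A) * (real k * norm (g k)) + 1 / \<beta> * (real k * norm (z k - z (k - 1)))) \<longlonglongrightarrow> 0"
    by simp
  then show ?thesis
  proof (rule Lim_null_comparison[rotated], intro always_eventually allI)
    fix k
    define e where "e = gradient h (x k) - gradient h (x (k - 1))"
    have "r k = (1 / \<tau>) *\<^sub>R fst (g k) - adjoint A (snd (g k)) + e"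
      unfolding primal_residual by (simp add: r_def e_def)
    then have "norm (r k) \<le> norm ((1 / \<tau>) *\<^sub>R fst (g k)) + norm (adjoint A (snd (g k))) + norm e"
      using norm_triangle_ineq[of "(1 / \<tau>) *\<^sub>R fst (g k) - adjoint A (snd (g k))" e]
        norm_triangle_ineq4[of "(1 / \<tau>) *\<^sub>R fst (g k)" "adjoint A (snd (g k))"] by simp
    also have "norm ((1 / \<tau>) *\<^sub>R fst (g k)) \<le> 1 / \<tau> * norm (g k)"
      using \<tau> norm_fst_le'[of "g k"] by (simp add: divide_right_mono)
    also have "norm (adjoint A (snd (g k))) \<le> onorm A * norm (g k)"
      using norm_adjoint_le[OF A, of "snd (g k)"] mult_left_mono[OF norm_snd_le'[of "g k"] onorm_pos_le[OF A]] by linarith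
    also have "norm e \<le> 1 / \<beta> * norm (z k - z (k - 1))"
      using lipschitz_onD[OF grad_h, of "x k" "x (k - 1)"] mult_left_mono[OF norm_fst_le'[of "z k - z (k - 1)"], of "1 / \<beta>"] \<beta>
      by (simp add: e_def dist_norm z_def)
    finally have "norm (r k) \<le> (1 / \<tau> + onorm A) * norm (g k) + 1 / \<beta> * norm (z k - z (k - 1))"
      by (simp add: distrib_right)
    from mult_left_mono[OF this, of "real k"]
    show "norm (real k * norm (r k)) \<le> (1 / \<tau> + onorm A) * (real k * norm (g k)) + 1 / \<beta> * (real k * norm (z k - z (k - 1)))"
      by (simp add: algebra_simps)
  qed
qed

lemma feasibility_rate: "(\<lambda>k. real k * norm (A (x k) - b)) \<longlonglongrightarrow> 0"
proof -
  have "(\<lambda>k. (1 / \<sigma> + onorm A) * (real k * norm (g k))) \<longlonglongrightarrow> (1 / \<sigma> + onorm A) * 0"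
    by (intro tendsto_intros g_rate)
  then have "(\<lambda>k. (1 / \<sigma> + onorm A) * (real k * norm (g k))) \<longlonglongrightarrow> 0" by simp
  moreover have "\<forall>\<^sub>F k in sequentially. norm (real k * norm (A (x k) - b)) \<le> (1 / \<sigma> + onorm A) * (real k * norm (g k))"
    using eventually_ge_at_top[of 1]
  proof eventually_elim
    case (elim k)
    have "norm (A (x k) - b) = norm ((1 / \<sigma>) *\<^sub>R snd (g k) - A (fst (g k)))"
      unfolding dual_residual[OF elim] by (rule norm_minus_commute)
    also have "\<dots> \<le> norm ((1 / \<sigma>) *\<^sub>R snd (g k)) + norm (A (fst (g k)))"
      by (rule norm_triangle_ineq4)
    also have "norm ((1 / \<sigma>) *\<^sub>R snd (g k)) \<le> 1 / \<sigma> * norm (g k)"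
      using \<sigma> norm_snd_le'[of "g k"] by (simp add: divide_right_mono)
    also have "norm (A (fst (g k))) \<le> onorm A * norm (g k)"
      using onorm[OF A, of "fst (g k)"] mult_left_mono[OF norm_fst_le'[of "g k"] onorm_pos_le[OF A]] by linarith
    finally have "norm (A (x k) - b) \<le> (1 / \<sigma> + onorm A) * norm (g k)"
      by (simp add: distrib_right)
    from mult_left_mono[OF this, of "real k"] show ?case by (simp add: mult_ac)
  qed
  ultimately show ?thesis by (rule Lim_null_comparison[rotated])
qed

lemma tendsto_if_rate:
  fixes s :: "nat \<Rightarrow> 'a::real_normed_vector"
  assumes "(\<lambda>k. real k * norm (s k)) \<longlonglongrightarrow> 0"
  shows "s \<longlonglongrightarrow> 0"
proof (rule Lim_null_comparison[OF _ assms])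
  show "\<forall>\<^sub>F k in sequentially. norm (s k) \<le> real k * norm (s k)"
    using eventually_ge_at_top[of 1]
    by eventually_elim (simp add: mult_le_cancel_right1)
qed

lemma inner_rate:
  fixes s w :: "nat \<Rightarrow> 'a::real_inner"
  assumes "(\<lambda>k. real k * norm (s k)) \<longlonglongrightarrow> 0" and bd: "\<And>k. norm (w k) \<le> R"
  shows "(\<lambda>k. real k * (s k \<bullet> w k)) \<longlonglongrightarrow> 0"
proof (rule Lim_null_comparison)
  have "(\<lambda>k. R * (real k * norm (s k))) \<longlonglongrightarrow> R * 0" by (intro tendsto_intros assms)
  then show "(\<lambda>k. R * (real k * norm (s k))) \<longlonglongrightarrow> 0" by simp
  have "\<bar>s k \<bullet> w k\<bar> \<le> R * norm (s k)" for k
    using Cauchy_Schwarz_ineq2[of "s k" "w k"] mult_left_mono[OF bd[of k] norm_ge_zero[of "s k"]]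
    by (simp add: mult.commute)
  then have "real k * \<bar>s k \<bullet> w k\<bar> \<le> real k * (R * norm (s k))" for k by (intro mult_left_mono) auto
  then show "\<forall>\<^sub>F k in sequentially. norm (real k * (s k \<bullet> w k)) \<le> R * (real k * norm (s k))"
    by (simp add: abs_mult mult_ac)
qed

section \<open>Function values and the Lagrangian gap\<close>

definition F where "F k = real_of_ereal (f (x k)) + h (x k)"
definition Fs where "Fs = real_of_ereal (f xs) + h xs"

lemma f_x: "k \<ge> 1 \<Longrightarrow> f (x k) = ereal (F k - h (x k))"
  using subdifferentialD(1)[OF t_subgradient[of k]] by (cases "f (x k)") (auto simp: F_def)

lemma f_xs: "f xs = ereal (Fs - h xs)"
  using subdifferentialD(1)[OF saddle_pointD(2)[OF saddle]] by (cases "f xs") (auto simp: Fs_def)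

text \<open>The subgradient inequalities of \<open>f\<close> and \<open>h\<close> are added, and the
  adjoint identity turns the multiplier term into residuals.\<close>

lemma value_upper_bound:
  assumes k: "k \<ge> 1" and fq: "f q = ereal s"
  shows "F k + r k \<bullet> (q - x k) + l k \<bullet> (A (x k) - b) \<le> s + h q + l k \<bullet> (A q - b)"
proof -
  have "F k - h (x k) + t k \<bullet> (q - x k) \<le> s"
    using subdifferentialD(2)[OF t_subgradient[OF k], of q] by (simp add: f_x[OF k] fq)
  moreover have "h (x k) + gradient h (x k) \<bullet> (q - x k) \<le> h q" by (rule convex_gradient_ineq[OF h])
  moreover have "adjoint A (l k) \<bullet> (q - x k) = l k \<bullet> (A q - b) - l k \<bullet> (A (x k) - b)"
    by (simp add: inner_commute[of "adjoint A _"] inner_commute[of "l k"] adjoint_hilbert[OF A, symmetric]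
        A.diff inner_diff_left)
  ultimately show ?thesis by (simp add: r_def inner_add_left)
qed

lemma value_lower_bound:
  assumes k: "k \<ge> 1"
  shows "Fs \<le> F k + ls \<bullet> (A (x k) - b)"
proof -
  have "L xs ls \<le> L (x k) ls" using saddle by (auto simp: saddle_points_def)
  then show ?thesis by (simp add: lagrangian_def f_x[OF k] f_xs saddle_pointD(1)[OF saddle])
qed

text \<open>The saddle property makes the gap nonnegative, and \<open>value_upper_bound\<close> at
  \<open>xs\<close> bounds it by residuals of order \<open>o(1/k)\<close> paired with bounded
  sequences. The value differs from the gap by a feasibility term of the same order.\<close>

lemma gap_rate: "(\<lambda>k. real k * (F k + ls \<bullet> (A (x k) - b) - Fs)) \<longlonglongrightarrow> 0"
  and value_rate: "(\<lambda>k. real k * \<bar>F k - Fs\<bar>) \<longlonglongrightarrow> 0"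
proof -
  obtain R where R: "\<And>k. norm (z k) \<le> R" using z_bounded by blast
  have "norm (x k - xs) \<le> R + norm xs" for k
    using norm_triangle_ineq4[of "x k" xs] norm_fst_le'[of "z k"] R[of k] by (simp add: z_def)
  from inner_rate[OF r_rate this] have 1: "(\<lambda>k. real k * (r k \<bullet> (x k - xs))) \<longlonglongrightarrow> 0" .
  have "norm (ls - l k) \<le> norm ls + R" for k
    using norm_triangle_ineq4[of ls "l k"] norm_snd_le'[of "z k"] R[of k] by (simp add: z_def)
  from inner_rate[OF feasibility_rate this] have 2: "(\<lambda>k. real k * ((A (x k) - b) \<bullet> (ls - l k))) \<longlonglongrightarrow> 0" .
  have 3: "(\<lambda>k. real k * ((A (x k) - b) \<bullet> ls)) \<longlonglongrightarrow> 0"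
    by (rule inner_rate[OF feasibility_rate order_refl])
  have "(\<lambda>k. real k * (r k \<bullet> (x k - xs)) + real k * ((A (x k) - b) \<bullet> (ls - l k))) \<longlonglongrightarrow> 0 + 0"
    by (intro tendsto_intros 1 2)
  then have up: "(\<lambda>k. real k * (r k \<bullet> (x k - xs)) + real k * ((A (x k) - b) \<bullet> (ls - l k))) \<longlonglongrightarrow> 0" by simp
  show gap: "(\<lambda>k. real k * (F k + ls \<bullet> (A (x k) - b) - Fs)) \<longlonglongrightarrow> 0"
  proof (rule Lim_null_comparison[OF _ up])
    show "\<forall>\<^sub>F k in sequentially. norm (real k * (F k + ls \<bullet> (A (x k) - b) - Fs))
        \<le> real k * (r k \<bullet> (x k - xs)) + real k * ((A (x k) - b) \<bullet> (ls - l k))"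
      using eventually_ge_at_top[of 1]
    proof eventually_elim
      case (elim k)
      have "F k + ls \<bullet> (A (x k) - b) - Fs \<le> r k \<bullet> (x k - xs) + (A (x k) - b) \<bullet> (ls - l k)"
        using value_upper_bound[OF elim f_xs] saddle_pointD(1)[OF saddle]
        by (simp add: inner_diff_right inner_commute[of "A (x k) - b"])
      from mult_left_mono[OF this, of "real k"] value_lower_bound[OF elim]
      show ?case by (simp add: abs_mult distrib_left)
    qed
  qed
  have "(\<lambda>k. real k * (F k + ls \<bullet> (A (x k) - b) - Fs) - real k * ((A (x k) - b) \<bullet> ls)) \<longlonglongrightarrow> 0 - 0"
    by (intro tendsto_intros gap 3)
  then have "(\<lambda>k. real k * (F k - Fs)) \<longlonglongrightarrow> 0"
    by (simp add: inner_commute[of ls] algebra_simps)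
  from tendsto_rabs_zero[OF this] show "(\<lambda>k. real k * \<bar>F k - Fs\<bar>) \<longlonglongrightarrow> 0"
    by (simp add: abs_mult)
qed

section \<open>Weak cluster points and weak convergence\<close>

lemma weak_cluster_point_saddle:
  assumes G: "G \<noteq> bot" "G \<le> sequentially" and q: "\<And>p. ((\<lambda>k. z k \<bullet> p) \<longlongrightarrow> q \<bullet> p) G"
  shows "q \<in> saddle_points L"
proof -
  obtain xq lq where q_eq: "q = (xq, lq)" by (cases q)
  have x: "((\<lambda>k. x k \<bullet> p) \<longlongrightarrow> xq \<bullet> p) G" for p
    using q[of "(p, 0)"] by (simp add: z_def q_eq inner_prod_def)
  have l: "((\<lambda>k. l k \<bullet> p) \<longlongrightarrow> lq \<bullet> p) G" for p
    using q[of "(0, p)"] by (simp add: z_def q_eq inner_prod_def)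
  obtain R where R: "\<And>k. norm (z k) \<le> R" using z_bounded by blast
  have k1: "\<forall>\<^sub>F k in G. k \<ge> 1" by (rule filter_leD[OF G(2) eventually_ge_at_top])
  \<comment> \<open>The residual tends to \<open>0\<close> strongly, while the adjoint moves
    \<open>A\<close> onto the test vector and permits the weak limit.\<close>
  have "A xq = b"
  proof (rule inner_left_unique)
    fix p
    have "((\<lambda>k. (A (x k) - b) \<bullet> p) \<longlongrightarrow> 0 \<bullet> p) G"
      by (intro tendsto_intros tendsto_mono[OF G(2) tendsto_if_rate[OF feasibility_rate]])
    moreover have "((\<lambda>k. (A (x k) - b) \<bullet> p) \<longlongrightarrow> A xq \<bullet> p - b \<bullet> p) G"
      unfolding inner_diff_left adjoint_hilbert[OF A] by (intro tendsto_intros x)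
    ultimately have "0 \<bullet> p = A xq \<bullet> p - b \<bullet> p" by (rule tendsto_unique[OF G(1)])
    then show "A xq \<bullet> p = b \<bullet> p" by simp
  qed
  \<comment> \<open>In \<open>value_upper_bound\<close>, \<open>f\<close> is replaced by an affine
    minorant and \<open>h\<close> by its tangent at \<open>xq\<close>. Every term is then affine in
    the iterate or tends to \<open>0\<close>, so the weak limit can be taken.\<close>
  have le: "f xq \<le> ereal (s + h q' + lq \<bullet> (A q' - b) - h xq)" if q': "f q' = ereal s" for q' s
  proof (rule lower_semicontinuous_le_if_affine_minorants_le[OF f saddle_pointD(2)[OF saddle]])
    fix p u assume u: "u \<in> subdifferential f p"
    then obtain fp where fp: "f p = ereal fp" using subdifferentialD(1)[OF u] by (cases "f p") auto
    define err where "err k = r k \<bullet> (q' - x k) + (A (x k) - b) \<bullet> l k" for k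
    have "(\<lambda>k. real k * (r k \<bullet> (q' - x k))) \<longlonglongrightarrow> 0"
    proof (rule inner_rate[OF r_rate])
      show "norm (q' - x k) \<le> norm q' + R" for k
        using norm_triangle_ineq4[of q' "x k"] norm_fst_le'[of "z k"] R[of k] by (simp add: z_def)
    qed
    moreover have "(\<lambda>k. real k * ((A (x k) - b) \<bullet> l k)) \<longlonglongrightarrow> 0"
    proof (rule inner_rate[OF feasibility_rate])
      show "norm (l k) \<le> R" for k
        using norm_snd_le'[of "z k"] R[of k] by (simp add: z_def)
    qed
    ultimately have "(\<lambda>k. real k * (r k \<bullet> (q' - x k)) + real k * ((A (x k) - b) \<bullet> l k)) \<longlonglongrightarrow> 0 + 0"
      by (rule tendsto_add)
    then have "(\<lambda>k. real k * err k) \<longlonglongrightarrow> 0" by (simp add: err_def distrib_left)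
    from tendsto_rabs_zero[OF this] have "(\<lambda>k. real k * norm (err k)) \<longlonglongrightarrow> 0" by (simp add: abs_mult)
    then have "err \<longlonglongrightarrow> 0" by (rule tendsto_if_rate)
    then have err: "(err \<longlongrightarrow> 0) G" by (rule tendsto_mono[OF G(2)])
    have "fp + (xq \<bullet> u - u \<bullet> p) + (h xq + (xq \<bullet> gradient h xq - gradient h xq \<bullet> xq)) + 0
        \<le> s + h q' + lq \<bullet> (A q' - b)"
    proof (rule tendsto_le[OF G(1)])
      show "((\<lambda>k. fp + (x k \<bullet> u - u \<bullet> p) + (h xq + (x k \<bullet> gradient h xq - gradient h xq \<bullet> xq)) + err k) \<longlongrightarrow>
          fp + (xq \<bullet> u - u \<bullet> p) + (h xq + (xq \<bullet> gradient h xq - gradient h xq \<bullet> xq)) + 0) G"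
        by (intro tendsto_add tendsto_diff tendsto_const x err)
      show "((\<lambda>k. s + h q' + l k \<bullet> (A q' - b)) \<longlongrightarrow> s + h q' + lq \<bullet> (A q' - b)) G"
        by (intro tendsto_add tendsto_const l)
      show "\<forall>\<^sub>F k in G. fp + (x k \<bullet> u - u \<bullet> p) + (h xq + (x k \<bullet> gradient h xq - gradient h xq \<bullet> xq)) + err k
          \<le> s + h q' + l k \<bullet> (A q' - b)"
        using k1
      proof eventually_elim
        case (elim k)
        have "fp + u \<bullet> (x k - p) \<le> F k - h (x k)"
          using subdifferentialD(2)[OF u, of "x k"] by (simp add: fp f_x[OF elim])
        moreover have "h xq + gradient h xq \<bullet> (x k - xq) \<le> h (x k)" by (rule convex_gradient_ineq[OF h])
        moreover note value_upper_bound[OF elim q']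
        ultimately show ?case
          by (simp add: err_def inner_diff_right inner_commute[of u] inner_commute[of "gradient h xq"]
              inner_commute[of "A (x k) - b"])
      qed
    qed
    then show "f p + ereal (u \<bullet> (xq - p)) \<le> ereal (s + h q' + lq \<bullet> (A q' - b) - h xq)"
      by (simp add: fp inner_diff_right inner_commute[of u] inner_commute[of "gradient h xq"])
  qed
  \<comment> \<open>The comparison point \<open>xs\<close> has finite value, which makes
    \<open>f xq\<close> finite.\<close>
  have "f xq \<noteq> \<infinity>" using le[OF f_xs] by auto
  then obtain s where s: "f xq = ereal s" using f_not_minf[of xq] by (cases "f xq") auto
  show ?thesis unfolding q_eq
  proof (rule saddle_pointI[OF \<open>A xq = b\<close> s])
    fix q' s' assume "f q' = ereal s'"
    from le[OF this] show "s + h xq \<le> s' + h q' + lq \<bullet> (A q' - b)" by (simp add: s)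
  qed
qed

text \<open>Opial's argument in the metric \<open>B\<close>.\<close>

lemma weak_cluster_point_unique:
  assumes G: "G \<noteq> bot" "G \<le> sequentially" "\<And>p. ((\<lambda>k. z k \<bullet> p) \<longlongrightarrow> q \<bullet> p) G"
    and G': "G' \<noteq> bot" "G' \<le> sequentially" "\<And>p. ((\<lambda>k. z k \<bullet> p) \<longlongrightarrow> q' \<bullet> p) G'"
  shows "q' = q"
proof -
  define e where "e = q - q'"
  define Me where "Me = ((1 / \<tau>) *\<^sub>R fst e - adjoint A (snd e), (1 / \<sigma>) *\<^sub>R snd e - A (fst e))"
  have B_Me: "B p e = p \<bullet> Me" for p
    by (simp add: B_def Me_def inner_prod_def inner_diff_right adjoint_hilbert[OF A]
        inner_commute[of "snd p" "A _"])
  \<comment> \<open>In the difference of squared distances to the two cluster points the square of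
    \<open>z k\<close> cancels; what remains is linear in \<open>z k\<close>.\<close>
  have "convergent (\<lambda>k. (B (z k - q') (z k - q') - B (z k - q) (z k - q) + (B q q - B q' q')) * (1 / 2))"
    by (intro convergent_mult convergent_add convergent_diff convergent_const B_dist_convergent
        weak_cluster_point_saddle[OF G] weak_cluster_point_saddle[OF G'])
  also have "(\<lambda>k. (B (z k - q') (z k - q') - B (z k - q) (z k - q) + (B q q - B q' q')) * (1 / 2)) = (\<lambda>k. z k \<bullet> Me)"
    unfolding B_Me[symmetric] e_def
    by (simp add: B.bilinear B.sym[of q "z _"] B.sym[of q' "z _"] fun_eq_iff)
  finally obtain c where c: "(\<lambda>k. z k \<bullet> Me) \<longlonglongrightarrow> c" unfolding convergent_def by blast
  have "q \<bullet> Me = c" by (rule tendsto_unique[OF G(1) G(3) tendsto_mono[OF G(2) c]])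
  moreover have "q' \<bullet> Me = c" by (rule tendsto_unique[OF G'(1) G'(3) tendsto_mono[OF G'(2) c]])
  ultimately have "B e e = 0" unfolding B_Me by (simp add: e_def inner_diff_left)
  then have "\<mu> * (norm e)\<^sup>2 \<le> 0" using B_coercive[of e] by simp
  then have "norm e = 0" using \<mu>_pos by (simp add: mult_le_0_iff)
  then show ?thesis by (simp add: e_def)
qed

lemma weak_convergence: "\<exists>q \<in> saddle_points L. weakly_tendsto z q"
proof -
  obtain R where R: "\<And>k. norm (z k) \<le> R" using z_bounded by blast
  obtain G q where G: "G \<noteq> bot" "G \<le> sequentially" "\<And>p. ((\<lambda>k. z k \<bullet> p) \<longlongrightarrow> q \<bullet> p) G"
    using bounded_imp_weakly_convergent_subfilter[OF sequentially_bot, of z R] R by blast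
  have "weakly_tendsto z q"
    by (rule weakly_tendstoI_cluster[OF R weak_cluster_point_unique[OF G]])
  with weak_cluster_point_saddle[OF G] show ?thesis by blast
qed

end

theorem theorem3p2:
  fixes f :: "'x::{real_inner, complete_space} \<Rightarrow> ereal"
    and h :: "'x \<Rightarrow> real"
    and A :: "'x \<Rightarrow> 'y::{real_inner, complete_space}"
    and b :: 'y
    and \<alpha> \<beta> \<tau> \<sigma> :: real
    and xs :: 'x and ls :: 'y
    and x v w :: "nat \<Rightarrow> 'x"
    and l \<eta> :: "nat \<Rightarrow> 'y"
  assumes f: "proper_fun f" "convex_ereal f" "lower_semicontinuous f"
    and h: "convex_on UNIV h" "h differentiable_on UNIV"
    and \<beta>: "\<beta> > 0"
    and grad_h: "(1 / \<beta>)-lipschitz_on UNIV (gradient h)"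
    and A: "bounded_linear A"
    and saddle: "(xs, ls) \<in> saddle_points (lagrangian f h A b)"
    and params: "\<alpha> > 2" "\<tau> > 0" "\<sigma> > 0"
    and step: "1 < min (1 / \<tau>) (1 / \<sigma>) * (1 - sqrt (\<tau> * \<sigma> * (onorm A)\<^sup>2))
                     * (8 * (\<alpha> - 1) / (5 * \<alpha> - 2)) * \<beta>"
    and x1: "x 1 = prox \<tau> f (v 0 - \<tau> *\<^sub>R adjoint A (\<eta> 0) - \<tau> *\<^sub>R gradient h (x 0))"
    and l1: "l 1 = \<eta> 0 + \<sigma> *\<^sub>R (A (x 1) - b) + \<sigma> *\<^sub>R A (x 1 - v 0)"
    and v: "\<And>k. k \<ge> 1 \<Longrightarrow>
       v k = x k + (1 - \<alpha> / (real k + \<alpha>)) *\<^sub>R (x k - x (k - 1))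
                 + (1 - \<alpha> / (2 * (real k + \<alpha>))) *\<^sub>R (v (k - 1) - x k)"
    and \<eta>: "\<And>k. k \<ge> 1 \<Longrightarrow>
       \<eta> k = l k + (1 - \<alpha> / (real k + \<alpha>)) *\<^sub>R (l k - l (k - 1))
                 + (1 - \<alpha> / (2 * (real k + \<alpha>))) *\<^sub>R (\<eta> (k - 1) - l k)"
    and x: "\<And>k. k \<ge> 1 \<Longrightarrow>
       x (k + 1) = prox \<tau> f (v k - \<tau> *\<^sub>R adjoint A (\<eta> k) - \<tau> *\<^sub>R gradient h (x k))"
    and l: "\<And>k. k \<ge> 1 \<Longrightarrow>
       l (k + 1) = \<eta> k + \<sigma> *\<^sub>R (A (x (k + 1)) - b) + \<sigma> *\<^sub>R A (x (k + 1) - v k)"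
    and w: "\<And>k. k \<ge> 1 \<Longrightarrow>
       w (k + 1) = (1 / \<tau>) *\<^sub>R (v k - x (k + 1)) + adjoint A (l (k + 1) - \<eta> k) - gradient h (x k)"
  shows "(\<exists>z \<in> saddle_points (lagrangian f h A b). weakly_tendsto (\<lambda>k. (x k, l k)) z) \<and>
    (\<forall>k\<ge>1. w (k + 1) \<in> (\<lambda>u. u + adjoint A (l (k + 1))) ` subdifferential f (x (k + 1))) \<and>
    (\<lambda>k. norm (x k - x (k - 1))) \<in> o(\<lambda>k. 1 / real k) \<and>
    (\<lambda>k. norm (l k - l (k - 1))) \<in> o(\<lambda>k. 1 / real k) \<and>
    (\<lambda>k. norm (w k + gradient h (x k))) \<in> o(\<lambda>k. 1 / real k) \<and>
    (\<lambda>k. norm (A (x k) - b)) \<in> o(\<lambda>k. 1 / real k) \<and>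
    smallo_ereal (\<lambda>k. lagrangian f h A b (x k) ls - lagrangian f h A b xs (l k)) (\<lambda>k. 1 / real k) \<and>
    smallo_ereal (\<lambda>k. \<bar>(f (x k) + ereal (h (x k))) - (f xs + ereal (h xs))\<bar>) (\<lambda>k. 1 / real k)"
proof -
  \<comment> \<open>The case \<open>k = 0\<close> is the initialisation.\<close>
  have x_step: "x (Suc k) = prox \<tau> f (v k - \<tau> *\<^sub>R adjoint A (\<eta> k) - \<tau> *\<^sub>R gradient h (x k))" for k
    using x1 x[of k] by (cases "k = 0") auto
  have l_step: "l (Suc k) = \<eta> k + \<sigma> *\<^sub>R (A (x (Suc k)) - b) + \<sigma> *\<^sub>R A (x (Suc k) - v k)" for k
    using l1 l[of k] by (cases "k = 0") auto
  interpret P: primal_dual_iteration f h A b \<beta> \<alpha> \<tau> \<sigma> xs ls x v l \<eta>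
    using f h \<beta> grad_h A saddle params step v \<eta> x_step l_step
    by (intro primal_dual_iteration.intro primal_dual_problem.intro primal_dual_iteration_axioms.intro)
  \<comment> \<open>\<open>w\<close> is prescribed only from index \<open>2\<close> on, so its rate
    is transferred eventually.\<close>
  have w_eq: "w k = P.t k + adjoint A (l k)" if "k \<ge> 2" for k
  proof -
    define j where "j = k - 1"
    have j: "k = j + 1" "j \<ge> 1" using that by (auto simp: j_def)
    show ?thesis using w[OF j(2)] by (simp add: j(1) P.t_def adjoint_hilbert_diff[OF A])
  qed
  have sub: "w (k + 1) \<in> (\<lambda>u. u + adjoint A (l (k + 1))) ` subdifferential f (x (k + 1))" if "k \<ge> 1" for k
    using P.t_subgradient[of "k + 1"] that by (simp add: w_eq)
  have dx: "(\<lambda>k. real k * norm (x k - x (k - 1))) \<longlonglongrightarrow> 0"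
    by (rule Lim_null_comparison[OF always_eventually P.z_step_rate])
      (use norm_fst_le'[of "P.z _ - P.z _"] in \<open>auto simp: P.z_def intro: mult_left_mono\<close>)
  have dl: "(\<lambda>k. real k * norm (l k - l (k - 1))) \<longlonglongrightarrow> 0"
    by (rule Lim_null_comparison[OF always_eventually P.z_step_rate])
      (use norm_snd_le'[of "P.z _ - P.z _"] in \<open>auto simp: P.z_def intro: mult_left_mono\<close>)
  have dw: "(\<lambda>k. real k * norm (w k + gradient h (x k))) \<longlonglongrightarrow> 0"
  proof (rule Lim_transform_eventually[OF P.r_rate])
    show "\<forall>\<^sub>F k in sequentially. real k * norm (P.r k) = real k * norm (w k + gradient h (x k))"
      using eventually_ge_at_top[of 2] by eventually_elim (simp add: w_eq P.r_def)
  qed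
  have gap: "smallo_ereal (\<lambda>k. lagrangian f h A b (x k) ls - lagrangian f h A b xs (l k)) (\<lambda>k. 1 / real k)"
  proof -
    \<comment> \<open>\<open>f\<close> may be infinite at the arbitrary start \<open>x 0\<close>;
      from \<open>k = 1\<close> on the proximal step keeps the values finite.\<close>
    have eq: "lagrangian f h A b (x k) ls - lagrangian f h A b xs (l k) = ereal (P.F k + ls \<bullet> (A (x k) - b) - P.Fs)"
      if "k \<ge> 1" for k
      by (simp add: lagrangian_def P.f_x[OF that] P.f_xs P.saddle_pointD(1)[OF saddle])
    have "(\<lambda>k. real k * real_of_ereal (lagrangian f h A b (x k) ls - lagrangian f h A b xs (l k))) \<longlonglongrightarrow> 0"
      by (rule Lim_transform_eventually[OF P.gap_rate])
        (use eventually_ge_at_top[of 1] in eventually_elim, simp add: eq)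
    moreover have "\<forall>\<^sub>F k in sequentially. \<bar>lagrangian f h A b (x k) ls - lagrangian f h A b xs (l k)\<bar> \<noteq> \<infinity>"
      using eventually_ge_at_top[of 1] by eventually_elim (simp add: eq)
    ultimately show ?thesis unfolding smallo_ereal_def by (blast intro: smallo_inverse_if_tendsto)
  qed
  have val: "smallo_ereal (\<lambda>k. \<bar>(f (x k) + ereal (h (x k))) - (f xs + ereal (h xs))\<bar>) (\<lambda>k. 1 / real k)"
  proof -
    have eq: "\<bar>(f (x k) + ereal (h (x k))) - (f xs + ereal (h xs))\<bar> = ereal \<bar>P.F k - P.Fs\<bar>" if "k \<ge> 1" for k
      by (simp add: P.f_x[OF that] P.f_xs)
    have "(\<lambda>k. real k * real_of_ereal \<bar>(f (x k) + ereal (h (x k))) - (f xs + ereal (h xs))\<bar>) \<longlonglongrightarrow> 0"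
      by (rule Lim_transform_eventually[OF P.value_rate])
        (use eventually_ge_at_top[of 1] in eventually_elim, simp add: eq)
    moreover have "\<forall>\<^sub>F k in sequentially. \<bar>\<bar>(f (x k) + ereal (h (x k))) - (f xs + ereal (h xs))\<bar>\<bar> \<noteq> \<infinity>"
      using eventually_ge_at_top[of 1] by eventually_elim (simp add: eq)
    ultimately show ?thesis unfolding smallo_ereal_def by (blast intro: smallo_inverse_if_tendsto)
  qed
  show ?thesis
    by (intro conjI allI impI sub gap val P.weak_convergence[unfolded P.z_def[abs_def]]
        dx[THEN smallo_inverse_if_tendsto] dl[THEN smallo_inverse_if_tendsto]
        dw[THEN smallo_inverse_if_tendsto] P.feasibility_rate[THEN smallo_inverse_if_tendsto])
qed

end
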